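(* Let $E$ be a Banach space with a continuous scalar product $\langle\cdot,\cdot\rangle$, $\mathcal D$ a domain in $E$ and $\mathcal J$ a symplector. Let $H\in C^2(E,\mathbb R)\cap\mathrm{Dif}(\mathcal D,\mathcal J)$ have a Hamiltonian flow $\Phi_t^H$. Let $G$ be a Lie group, and $\Phi$ a globally Hamiltonian $G$-action on $E$ with $\mathrm{Ad}^*$-equivariant momentum map $F\in C^2(E,\mathbb R^m)$, $\mathbb R^m\simeq\mathfrak g^*$. Let $\mu_*\in\mathbb R^m\simeq\mathfrak g^*$, $\Sigma_{\mu_*}=\{u\in E\mid F(u)=\mu_*\}$ and $u_{\mu_*}\in\mathcal D\cap\Sigma_{\mu_*}$. Suppose that: - for all $g\in G$, $\Phi_g$ is linear and preserves both $\langle\cdot,\cdot\rangle$ and the norm $\|\cdot\|$; - $\mathrm{Ad}_g^*\in\mathrm O(m)$ for all $g\in G_{\mu_*}$; - $\mu_*$ is a regular value of $F$; - $H\circ\Phi_g=H$ for all $g\in G$. Let $\mathcal L_{\mu_*}=H-\xi_{\mu_*}\cdot F$ with $\xi_{\mu_*}\in\mathfrak g_{\mu_*}$ such that $D_{u_{\mu_*}}\mathcal L_{\mu_*}=0$. Suppose in addition that for all $j=1,\dots,m$ there exists $\nabla F_j(u_{\mu_*})\in E$ such that $D_{u_{\mu_*}}F_j(w)=\langle\nabla F_j(u_{\mu_*}),w\rangle$ for all $w\in E$, and that (a) $G_{\mu_*}$ is commutative; (b) there exists $C>0$ such that $D^2_{u_{\mu_*}}\mathcal L_{\mu_*}(w,w)\le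 C\|w\|^2$ for all $w\in E$; (c) there exists $c>0$ such that, with $\mathcal O_{u_{\mu_*}}=\{\Phi_g(u_{\mu_*})\mid g\in G_{\mu_*}\}$, $$\forall w\in T_{u_{\mu_*}}\Sigma_{\mu_*}\cap(T_{u_{\mu_*}}\mathcal O_{u_{\mu_*}})^\perp,\quad D^2_{u_{\mu_*}}\mathcal L_{\mu_*}(w,w)\ge c\|w\|^2.$$ Then all $u\in\mathcal O_{u_{\mu_*}}$ are orbitally stable $G_{\mu_*}$-relative equilibria (of $\Phi_t^H$).
   Context: $E$ is a real Banach space with norm $\|\cdot\|$, $\mathrm d(u,v)=\|u-v\|$; a domain is a dense subset of $E$. A continuous scalar product on $E$ is an inner product with $|\langle v,w\rangle|\le\|v\|\,\|w\|$. A symplector is a continuous injective linear map $\mathcal J:E\to E^*$ with $(\mathcal Ju)(v)=-(\mathcal Jv)(u)$; $\mathcal R_{\mathcal J}$ is its range. $\mathrm{Dif}(\mathcal D,\mathcal J)$ is the set of functions $F:E\to\mathbb R$ Fréchet differentiable at every $u\in\mathcal D$ with $D_uF\in\mathcal R_{\mathcal J}$. A Hamiltonian flow for $F\in\mathrm{Dif}(\mathcal D,\mathcal J)$ is a separately continuous map $\Phi^F:\mathbb R\times E\to E$ with $\Phi^F_{t+s}=\Phi^F_t\circ\Phi^F_s$, $\Phi^F_0=\mathrm{Id}$, $\Phi^F_t(\mathcal D)=\mathcal D$, and such that for all $u\in\mathcal D$ the curve $u(t)=\Phi^F_t(u)\in\mathcal D\subset E$ is differentiable and is the unique solution of $\mathcal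 J\dot u(t)=D_{u(t)}F$, $u(0)=u$. A map $\Phi\in C^0(E,E)\cap C^1(\mathcal D,E)$ is symplectic if $(\mathcal JD_u\Phi(v))(D_u\Phi(w))=(\mathcal Jv)(w)$ for all $u\in\mathcal D$, $v,w\in E$. Actions are separately continuous; Lie groups are matrix Lie groups. An action $\Phi$ of $G$ (Lie algebra $\mathfrak g$, dimension $m$) is globally Hamiltonian if every $\Phi_g\in C^1(E,E)$ is symplectic, $\Phi_g(\mathcal D)=\mathcal D$, and for each $\xi\in\mathfrak g$ there is $F_\xi\in C^1(E,\mathbb R)\cap\mathrm{Dif}(\mathcal D,\mathcal J)$ with $\Phi_{\exp(t\xi)}=\Phi_t^{F_\xi}$, $\xi\mapsto F_\xi$ linear. With a basis $e_1,\dots,e_m$ of $\mathfrak g$ one identifies $\mathfrak g\simeq\mathbb R^m$, $\mathfrak g^*\simeq\mathbb R^m$ (dual basis); the momentum map is $F=(F_{e_1},\dots,F_{e_m})$ and $F_\xi=\xi\cdot F$. It is $\mathrm{Ad}^*$-equivariant if $F\circ\Phi_g=\mathrm{Ad}^*_gF$, where $(\mathrm{Ad}^*_g\mu)(\xi)=\mu(\mathrm{Ad}_{g^{-1}}\xi)$. "$\mathrm{Ad}^*_g\in\mathrm O(m)$" means that, in the chosen basis, the matrix of $\mathrm{Ad}_g^*$ is orthogonal. $G_\mu=\{g\in G\mid\mathrm{Ad}_g^*\mu=\mu\}$, with Lie algebra $\mathfrak g_\mu$. $\mu_*$ is a regular value of $F$ if $\Sigma_{\mu_*}\neq\emptyset$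 and $D_uF$ is surjective for all $u\in\Sigma_{\mu_*}$; $T_u\Sigma_{\mu_*}=\ker D_uF$. $T_u\mathcal O_{u_{\mu_*}}=\{X_\xi(u)\mid\xi\in\mathfrak g_{\mu_*}\}$ with $X_\xi(u)=\frac{\mathrm d}{\mathrm dt}\Phi_{\exp(t\xi)}(u)|_{t=0}$, and $\perp$ denotes the orthogonal complement in $E$ with respect to $\langle\cdot,\cdot\rangle$. $u$ is a $G_{\mu_*}$-relative equilibrium if $u(t):=\Phi_t^H(u)\in\mathcal O_u:=\{\Phi_g(u)\mid g\in G_{\mu_*}\}$ for all $t$. It is orbitally stable if for all $\epsilon>0$ there is $\delta>0$ such that for all $v\in E$: $\mathrm d(v,u)\le\delta\Rightarrow\forall t\in\mathbb R,\ \inf_{t'\in\mathbb R}\mathrm d(\Phi_t^H(v),\mathcal O_{u(t')})\le\epsilon$. *)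

theory Defs
  imports "HOL-Analysis.Analysis"
begin

section \<open>Differential calculus on Banach spaces\<close>

text \<open>Only meaningful where \<open>f\<close> is Frechet differentiable.\<close>

definition Dblin ::
    "('a::real_normed_vector \<Rightarrow> 'b::real_normed_vector) \<Rightarrow> 'a \<Rightarrow> 'a \<Rightarrow>\<^sub>L 'b" where
  "Dblin f u = Blinfun (frechet_derivative f (at u))"

text \<open>Differentiability is differentiability in \<open>E\<close> (not within \<open>S\<close>) at the points of \<open>S\<close>.\<close>

definition C1_on :: "'a::real_normed_vector set \<Rightarrow> ('a \<Rightarrow> 'b::real_normed_vector) \<Rightarrow> bool" where
  "C1_on S f \<longleftrightarrow> (\<forall>u\<in>S. f differentiable (at u)) \<and> continuous_on S (Dblin f)"

definition C2 :: "('a::real_normed_vector \<Rightarrow> 'b::real_normed_vector) \<Rightarrow> bool" where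
  "C2 f \<longleftrightarrow> C1_on UNIV f \<and> C1_on UNIV (Dblin f)"

definition D2 ::
    "('a::real_normed_vector \<Rightarrow> 'b::real_normed_vector) \<Rightarrow> 'a \<Rightarrow> 'a \<Rightarrow> 'a \<Rightarrow> 'b" where
  "D2 f u v w = blinfun_apply (blinfun_apply (Dblin (Dblin f) u) v) w"


section \<open>Scalar products, symplectors, Hamiltonian flows\<close>

definition continuous_scalar_product :: "('a::real_normed_vector \<Rightarrow> 'a \<Rightarrow> real) \<Rightarrow> bool" where
  "continuous_scalar_product ip \<longleftrightarrow>
     (\<forall>v. linear (ip v)) \<and> (\<forall>v w. ip v w = ip w v) \<and> (\<forall>v. v \<noteq> 0 \<longrightarrow> 0 < ip v v) \<and>
     (\<forall>v w. \<bar>ip v w\<bar> \<le> norm v * norm w)"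

definition ip_orth :: "('a \<Rightarrow> 'a \<Rightarrow> real) \<Rightarrow> 'a set \<Rightarrow> 'a set" where
  "ip_orth ip S = {w. \<forall>z\<in>S. ip w z = 0}"

definition is_domain :: "'a::real_normed_vector set \<Rightarrow> bool" where
  "is_domain D \<longleftrightarrow> closure D = UNIV"

definition symplector :: "('a::real_normed_vector \<Rightarrow> 'a \<Rightarrow>\<^sub>L real) \<Rightarrow> bool" where
  "symplector J \<longleftrightarrow> bounded_linear J \<and> inj J \<and>
     (\<forall>u v. blinfun_apply (J u) v = - blinfun_apply (J v) u)"

definition Dif :: "'a::real_normed_vector set \<Rightarrow> ('a \<Rightarrow> 'a \<Rightarrow>\<^sub>L real) \<Rightarrow> ('a \<Rightarrow> real) set" where
  "Dif D J = {F. \<forall>u\<in>D. F differentiable (at u) \<and> Dblin F u \<in> range J}"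

definition hamilton_solution ::
    "'a::real_normed_vector set \<Rightarrow> ('a \<Rightarrow> 'a \<Rightarrow>\<^sub>L real) \<Rightarrow> ('a \<Rightarrow> real) \<Rightarrow> 'a \<Rightarrow> (real \<Rightarrow> 'a) \<Rightarrow> bool"
  where
  "hamilton_solution D J F u x \<longleftrightarrow> x 0 = u \<and>
     (\<forall>t. x t \<in> D \<and> x differentiable (at t) \<and> J (vector_derivative x (at t)) = Dblin F (x t))"

definition hamiltonian_flow ::
    "'a::real_normed_vector set \<Rightarrow> ('a \<Rightarrow> 'a \<Rightarrow>\<^sub>L real) \<Rightarrow> ('a \<Rightarrow> real) \<Rightarrow> (real \<Rightarrow> 'a \<Rightarrow> 'a) \<Rightarrow> bool"
  where
  "hamiltonian_flow D J F \<Phi> \<longleftrightarrow>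
     (\<forall>u. continuous_on UNIV (\<lambda>t. \<Phi> t u)) \<and> (\<forall>t. continuous_on UNIV (\<Phi> t)) \<and>
     (\<forall>t s. \<Phi> (t + s) = \<Phi> t \<circ> \<Phi> s) \<and> \<Phi> 0 = id \<and> (\<forall>t. \<Phi> t ` D = D) \<and>
     (\<forall>u\<in>D. hamilton_solution D J F u (\<lambda>t. \<Phi> t u) \<and>
        (\<forall>x. hamilton_solution D J F u x \<longrightarrow> x = (\<lambda>t. \<Phi> t u)))"

definition symplectic_map ::
    "'a::real_normed_vector set \<Rightarrow> ('a \<Rightarrow> 'a \<Rightarrow>\<^sub>L real) \<Rightarrow> ('a \<Rightarrow> 'a) \<Rightarrow> bool" where
  "symplectic_map D J \<Phi> \<longleftrightarrow> continuous_on UNIV \<Phi> \<and> C1_on D \<Phi> \<and>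
     (\<forall>u\<in>D. \<forall>v w. blinfun_apply (J (blinfun_apply (Dblin \<Phi> u) v)) (blinfun_apply (Dblin \<Phi> u) w)
        = blinfun_apply (J v) w)"


section \<open>Matrix Lie groups\<close>

text \<open>A matrix Lie group is a subgroup of the general linear group that is closed in it (not
  necessarily closed in the space of all matrices). Complex matrix groups are covered by realification.\<close>

definition matrix_lie_group :: "(real^'n^'n) set \<Rightarrow> bool" where
  "matrix_lie_group G \<longleftrightarrow> G \<subseteq> {A. invertible A} \<and> mat 1 \<in> G \<and>
     (\<forall>g\<in>G. \<forall>h\<in>G. g ** h \<in> G) \<and> (\<forall>g\<in>G. matrix_inv g \<in> G) \<and>
     closedin (top_of_set {A. invertible A}) G"

definition mexp :: "real^'n^'n \<Rightarrow> real^'n^'n" where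
  "mexp A = (\<Sum>k. (1 / fact k) *\<^sub>R (((**) A ^^ k) (mat 1)))"

definition lie_algebra :: "(real^'n^'n) set \<Rightarrow> (real^'n^'n) set" where
  "lie_algebra G = {\<xi>. \<forall>t::real. mexp (t *\<^sub>R \<xi>) \<in> G}"

definition Ad :: "real^'n^'n \<Rightarrow> real^'n^'n \<Rightarrow> real^'n^'n" where
  "Ad g \<xi> = g ** \<xi> ** matrix_inv g"

text \<open>The dimension \<open>m\<close> of the group may be \<open>0\<close>, so \<open>\<real>\<^sup>m\<close> is rendered as
  \<open>{..<m} \<rightarrow>\<^sub>E UNIV\<close> (the indices \<open>1, \<dots>, m\<close> are shifted to \<open>0, \<dots>, m - 1\<close>) rather than by a
  type-indexed vector. Below, \<open>e\<close> is a basis of the Lie algebra and elements of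
  \<open>{..<m} \<rightarrow>\<^sub>E UNIV\<close> are coordinate vectors of functionals in the dual basis.\<close>

definition lie_basis :: "(real^'n^'n) set \<Rightarrow> nat \<Rightarrow> (nat \<Rightarrow> real^'n^'n) \<Rightarrow> bool" where
  "lie_basis G m e \<longleftrightarrow> inj_on e {..<m} \<and> independent (e ` {..<m}) \<and>
     span (e ` {..<m}) = lie_algebra G"

definition coord :: "nat \<Rightarrow> (nat \<Rightarrow> real^'n^'n) \<Rightarrow> real^'n^'n \<Rightarrow> nat \<Rightarrow> real" where
  "coord m e \<xi> j = representation (e ` {..<m}) \<xi> (e j)"

definition pairing ::
    "nat \<Rightarrow> (nat \<Rightarrow> real^'n^'n) \<Rightarrow> (nat \<Rightarrow> real) \<Rightarrow> real^'n^'n \<Rightarrow> real" where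
  "pairing m e \<mu> \<xi> = (\<Sum>j<m. coord m e \<xi> j * \<mu> j)"

text \<open>The dual-basis coordinates of a functional are its values on the basis vectors.\<close>

definition Ad_star ::
    "nat \<Rightarrow> (nat \<Rightarrow> real^'n^'n) \<Rightarrow> real^'n^'n \<Rightarrow> (nat \<Rightarrow> real) \<Rightarrow> nat \<Rightarrow> real" where
  "Ad_star m e g \<mu> = (\<lambda>i\<in>{..<m}. pairing m e \<mu> (Ad (matrix_inv g) (e i)))"

definition Ad_star_entry ::
    "nat \<Rightarrow> (nat \<Rightarrow> real^'n^'n) \<Rightarrow> real^'n^'n \<Rightarrow> nat \<Rightarrow> nat \<Rightarrow> real" where
  "Ad_star_entry m e g i j = Ad_star m e g (\<lambda>k\<in>{..<m}. if k = j then 1 else 0) i"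

definition Ad_star_orthogonal :: "nat \<Rightarrow> (nat \<Rightarrow> real^'n^'n) \<Rightarrow> real^'n^'n \<Rightarrow> bool" where
  "Ad_star_orthogonal m e g \<longleftrightarrow>
     (\<forall>i<m. \<forall>j<m. (\<Sum>k<m. Ad_star_entry m e g k i * Ad_star_entry m e g k j)
        = (if i = j then 1 else 0))"

definition stabilizer ::
    "(real^'n^'n) set \<Rightarrow> nat \<Rightarrow> (nat \<Rightarrow> real^'n^'n) \<Rightarrow> (nat \<Rightarrow> real) \<Rightarrow> (real^'n^'n) set" where
  "stabilizer G m e \<mu> = {g\<in>G. Ad_star m e g \<mu> = \<mu>}"


section \<open>Hamiltonian group actions and momentum maps\<close>

definition group_action ::
    "(real^'n^'n) set \<Rightarrow> (real^'n^'n \<Rightarrow> 'a::real_normed_vector \<Rightarrow> 'a) \<Rightarrow> bool" where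
  "group_action G \<Phi> \<longleftrightarrow> \<Phi> (mat 1) = id \<and> (\<forall>g\<in>G. \<forall>h\<in>G. \<Phi> (g ** h) = \<Phi> g \<circ> \<Phi> h) \<and>
     (\<forall>u. continuous_on G (\<lambda>g. \<Phi> g u)) \<and> (\<forall>g\<in>G. continuous_on UNIV (\<Phi> g))"

text \<open>\<open>Fam \<xi>\<close> is the Hamiltonian \<open>F\<^sub>\<xi>\<close>; it is relevant only for \<open>\<xi>\<close> in the Lie algebra.\<close>

definition globally_hamiltonian ::
    "'a::real_normed_vector set \<Rightarrow> ('a \<Rightarrow> 'a \<Rightarrow>\<^sub>L real) \<Rightarrow> (real^'n^'n) set \<Rightarrow>
     (real^'n^'n \<Rightarrow> 'a \<Rightarrow> 'a) \<Rightarrow> (real^'n^'n \<Rightarrow> 'a \<Rightarrow> real) \<Rightarrow> bool" where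
  "globally_hamiltonian D J G \<Phi> Fam \<longleftrightarrow> group_action G \<Phi> \<and>
     (\<forall>g\<in>G. C1_on UNIV (\<Phi> g) \<and> symplectic_map D J (\<Phi> g) \<and> \<Phi> g ` D = D) \<and>
     (\<forall>\<xi>\<in>lie_algebra G. C1_on UNIV (Fam \<xi>) \<and> Fam \<xi> \<in> Dif D J \<and>
        hamiltonian_flow D J (Fam \<xi>) (\<lambda>t. \<Phi> (mexp (t *\<^sub>R \<xi>)))) \<and>
     (\<forall>\<xi>\<in>lie_algebra G. \<forall>\<eta>\<in>lie_algebra G. \<forall>a b u.
        Fam (a *\<^sub>R \<xi> + b *\<^sub>R \<eta>) u = a * Fam \<xi> u + b * Fam \<eta> u)"

definition momentum ::
    "nat \<Rightarrow> (nat \<Rightarrow> real^'n^'n) \<Rightarrow> (real^'n^'n \<Rightarrow> 'a \<Rightarrow> real) \<Rightarrow> 'a \<Rightarrow> nat \<Rightarrow> real" where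
  "momentum m e Fam u = (\<lambda>j\<in>{..<m}. Fam (e j) u)"

definition D_momentum ::
    "nat \<Rightarrow> (nat \<Rightarrow> real^'n^'n) \<Rightarrow> (real^'n^'n \<Rightarrow> 'a::real_normed_vector \<Rightarrow> real) \<Rightarrow> 'a \<Rightarrow>
     'a \<Rightarrow> nat \<Rightarrow> real" where
  "D_momentum m e Fam u w = (\<lambda>j\<in>{..<m}. blinfun_apply (Dblin (Fam (e j)) u) w)"

definition Ad_star_equivariant ::
    "(real^'n^'n) set \<Rightarrow> nat \<Rightarrow> (nat \<Rightarrow> real^'n^'n) \<Rightarrow> (real^'n^'n \<Rightarrow> 'a \<Rightarrow> 'a) \<Rightarrow>
     (real^'n^'n \<Rightarrow> 'a \<Rightarrow> real) \<Rightarrow> bool" where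
  "Ad_star_equivariant G m e \<Phi> Fam \<longleftrightarrow>
     (\<forall>g\<in>G. \<forall>u. momentum m e Fam (\<Phi> g u) = Ad_star m e g (momentum m e Fam u))"

definition level_set ::
    "nat \<Rightarrow> (nat \<Rightarrow> real^'n^'n) \<Rightarrow> (real^'n^'n \<Rightarrow> 'a \<Rightarrow> real) \<Rightarrow> (nat \<Rightarrow> real) \<Rightarrow> 'a set" where
  "level_set m e Fam \<mu> = {u. momentum m e Fam u = \<mu>}"

definition regular_value ::
    "nat \<Rightarrow> (nat \<Rightarrow> real^'n^'n) \<Rightarrow> (real^'n^'n \<Rightarrow> 'a::real_normed_vector \<Rightarrow> real) \<Rightarrow>
     (nat \<Rightarrow> real) \<Rightarrow> bool" where
  "regular_value m e Fam \<mu> \<longleftrightarrow> level_set m e Fam \<mu> \<noteq> {} \<and>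
     (\<forall>u\<in>level_set m e Fam \<mu>. range (D_momentum m e Fam u) = {..<m} \<rightarrow>\<^sub>E UNIV)"

definition tangent_level ::
    "nat \<Rightarrow> (nat \<Rightarrow> real^'n^'n) \<Rightarrow> (real^'n^'n \<Rightarrow> 'a::real_normed_vector \<Rightarrow> real) \<Rightarrow> 'a \<Rightarrow>
     'a set" where
  "tangent_level m e Fam u = {w. D_momentum m e Fam u w = (\<lambda>j\<in>{..<m}. 0)}"

definition orbit :: "(real^'n^'n \<Rightarrow> 'a \<Rightarrow> 'a) \<Rightarrow> (real^'n^'n) set \<Rightarrow> 'a \<Rightarrow> 'a set" where
  "orbit \<Phi> K u = {\<Phi> g u | g. g \<in> K}"

definition tangent_orbit ::
    "(real^'n^'n \<Rightarrow> 'a::real_normed_vector \<Rightarrow> 'a) \<Rightarrow> (real^'n^'n) set \<Rightarrow> 'a \<Rightarrow> 'a set" where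
  "tangent_orbit \<Phi> K u =
     {vector_derivative (\<lambda>t::real. \<Phi> (mexp (t *\<^sub>R \<xi>)) u) (at 0) | \<xi>. \<xi> \<in> lie_algebra K}"

definition lagrangian ::
    "nat \<Rightarrow> (nat \<Rightarrow> real^'n^'n) \<Rightarrow> (real^'n^'n \<Rightarrow> 'a \<Rightarrow> real) \<Rightarrow> ('a \<Rightarrow> real) \<Rightarrow> real^'n^'n \<Rightarrow>
     'a \<Rightarrow> real" where
  "lagrangian m e Fam H \<xi> u = H u - pairing m e (momentum m e Fam u) \<xi>"


section \<open>Relative equilibria and orbital stability\<close>

definition relative_equilibrium ::
    "(real^'n^'n) set \<Rightarrow> (real^'n^'n \<Rightarrow> 'a \<Rightarrow> 'a) \<Rightarrow> (real \<Rightarrow> 'a \<Rightarrow> 'a) \<Rightarrow> 'a \<Rightarrow> bool" where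
  "relative_equilibrium K \<Phi> flow u \<longleftrightarrow> (\<forall>t. flow t u \<in> orbit \<Phi> K u)"

definition orbitally_stable ::
    "(real^'n^'n) set \<Rightarrow> (real^'n^'n \<Rightarrow> 'a::real_normed_vector \<Rightarrow> 'a) \<Rightarrow> (real \<Rightarrow> 'a \<Rightarrow> 'a) \<Rightarrow>
     'a \<Rightarrow> bool" where
  "orbitally_stable K \<Phi> flow u \<longleftrightarrow>
     (\<forall>\<epsilon>>0. \<exists>\<delta>>0. \<forall>v. dist v u \<le> \<delta> \<longrightarrow>
        (\<forall>t. (INF t'. infdist (flow t v) (orbit \<Phi> K (flow t' u))) \<le> \<epsilon>))"

end

theory Submission
  imports Defs
begin

text \<open>The Lyapunov function is the augmented Lagrangian
  \<open>V = H - \<xi>\<^sub>\<mu> \<cdot> F + \<kappa> \<parallel>F - \<mu>\<parallel>\<^sup>2\<close>. It is conserved by the flow (Noether) and \<open>G\<^sub>\<mu>\<close>-invariant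
  (commutativity of \<open>G\<^sub>\<mu>\<close> for \<open>\<xi>\<^sub>\<mu> \<cdot> F\<close>, orthogonality of \<open>Ad\<^sup>*\<close> for the penalty). The gradients of the
  \<open>F\<^sub>j\<close> are orthogonal to the orbit and span a finite-dimensional complement of \<open>T\<Sigma>\<^sub>\<mu>\<close>, so for large
  \<open>\<kappa>\<close> coercivity extends from \<open>T\<Sigma>\<^sub>\<mu> \<inter> (T\<O>)\<^sup>\<bottom>\<close> to all of \<open>(T\<O>)\<^sup>\<bottom>\<close>. Every point close to the orbit
  can be moved by some \<open>g \<in> G\<^sub>\<mu>\<close> into \<open>u\<^sub>\<mu> + (T\<O>)\<^sup>\<bottom>\<close>; hence near the orbit \<open>V - V(u\<^sub>\<mu>)\<close> dominates the
  squared distance to it, and the intermediate value theorem confines the flow.\<close>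

text \<open>The scalar product may be weaker than the norm, and \<open>E\<close> need not be
  complete for it, so orthogonal projections are used only onto finite-dimensional spaces, while
  coercivity is a statement about the norm. This is why the complement of the level set's tangent
  space is a span of finitely many gradients, with a projection bounded explicitly in norm. A
  perturbed initial point usually has a momentum other than \<open>\<mu>\<close>; the penalty
  handles all momenta at once and avoids comparison with a neighbouring level set. Derivatives along
  group orbits and along the flow are known only at points of \<open>D\<close>, whereas
  perturbations are arbitrary points of \<open>E\<close>: such derivatives are taken on
  \<open>D\<close>, and the resulting identities pass to \<open>E\<close> by density. No manifold
  structure of the orbit is used. The element moving a point into the slice comes from a
  minimisation over a compact ball of the Lie algebra of the stabiliser; commutativity makes the
  exponential additive there, and regularity of \<open>\<mu>\<close> keeps the parametrised orbit
  from returning to its base point on the boundary of that ball.\<close>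

section \<open>Coercivity and second-order expansions\<close>

text \<open>Gram-Schmidt as an induction on \<open>I\<close>. The projection \<open>p\<close> is
  bounded in the norm by the finitely many numbers \<open>ip (z i) w\<close>, although orthogonality
  refers only to \<open>ip\<close>. The vectors may be linearly dependent.\<close>

lemma span_orthogonal_split:
  fixes ip :: "'a::real_normed_vector \<Rightarrow> 'a \<Rightarrow> real"
  assumes "continuous_scalar_product ip" and "finite I"
  shows "\<exists>C\<ge>0. \<forall>w. \<exists>p\<in>span (z ` I). (\<forall>i\<in>I. ip (z i) (w - p) = 0) \<and>
    norm p \<le> C * (\<Sum>i\<in>I. \<bar>ip (z i) w\<bar>)"
  using assms(2)
proof (induction I)
  case empty
  show ?case by (auto intro!: exI[of _ 0])
next
  case (insert k I)
  interpret l: linear "ip v" for v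
    using assms(1) by (simp add: continuous_scalar_product_def)
  have sym: "ip v w = ip w v" for v w
    using assms(1) by (simp add: continuous_scalar_product_def)
  have pos: "v \<noteq> 0 \<Longrightarrow> 0 < ip v v" for v
    using assms(1) by (simp add: continuous_scalar_product_def)
  let ?S = "\<lambda>w. \<Sum>i\<in>I. \<bar>ip (z i) w\<bar>"
  obtain C where C: "C \<ge> 0" and split: "\<And>w. \<exists>p\<in>span (z ` I). (\<forall>i\<in>I. ip (z i) (w - p) = 0) \<and>
      norm p \<le> C * ?S w"
    using insert.IH by blast
  have bound: "\<exists>M\<ge>0. \<forall>w. \<bar>ip w p\<bar> \<le> M * ?S w" if "p \<in> span (z ` I)" for p
    using that
  proof (induction rule: span_induct_alt)
    case base
    show ?case by (auto simp: l.zero intro!: exI[of _ 0])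
  next
    case (step c x y)
    then obtain i M where i: "i \<in> I" "x = z i" and M: "M \<ge> 0" "\<And>w. \<bar>ip w y\<bar> \<le> M * ?S w" by auto
    have "\<bar>ip w (c *\<^sub>R x + y)\<bar> \<le> (\<bar>c\<bar> + M) * ?S w" for w
    proof -
      have "\<bar>ip (z i) w\<bar> \<le> ?S w" using i insert.hyps(1)
        by (intro member_le_sum) auto
      then have "\<bar>c\<bar> * \<bar>ip w x\<bar> \<le> \<bar>c\<bar> * ?S w" unfolding i(2) sym[of w]
        by (rule mult_left_mono) simp
      then show ?thesis using M(2)[of w] abs_triangle_ineq[of "c * ip w x" "ip w y"]
        by (simp add: l.add l.scale abs_mult algebra_simps)
    qed
    then show ?case using M(1) by (intro exI[of _ "\<bar>c\<bar> + M"]) auto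
  qed
  obtain p where p: "p \<in> span (z ` I)" and orth: "\<forall>i\<in>I. ip (z i) (z k - p) = 0"
    using split by blast
  obtain M where M: "M \<ge> 0" "\<And>w. \<bar>ip w p\<bar> \<le> M * ?S w" using bound[OF p] by blast
  define q where "q = z k - p"
  have q_orth: "ip q y = 0" if "y \<in> span (z ` I)" for y
    using that
    by (induction rule: span_induct_alt)
      (use orth in \<open>auto simp: l.zero l.add l.scale q_def sym[of "z k - p"]\<close>)
  have span_mono': "y \<in> span (z ` insert k I)" if "y \<in> span (z ` I)" for y
    using that span_mono[of "z ` I" "z ` insert k I"] by auto
  have q_span: "q \<in> span (z ` insert k I)"
    unfolding q_def by (intro span_diff span_base span_mono'[OF p]) auto
  let ?S' = "\<lambda>w. \<Sum>i\<in>insert k I. \<bar>ip (z i) w\<bar>"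
  have S': "?S' w = \<bar>ip (z k) w\<bar> + ?S w" for w using insert.hyps by simp
  have S0: "?S w \<ge> 0" for w by (simp add: sum_nonneg)
  \<comment> \<open>\<open>1 + M\<close> bounds \<open>ip q w\<close> by the sum of the
    \<open>\<bar>ip (z i) w\<bar>\<close>; \<open>norm q / ip q q\<close> turns the bound into one
    for the component along \<open>q\<close>.\<close>
  define N where "N = (1 + M) * (norm q / ip q q)"
  have ipq: "ip q q \<ge> 0" using pos[of q] by (cases "q = 0") (auto simp: l.zero)
  have N: "N \<ge> 0" unfolding N_def using M ipq by auto
  have "\<exists>p'\<in>span (z ` insert k I). (\<forall>i\<in>insert k I. ip (z i) (w - p') = 0) \<and>
      norm p' \<le> (C + N) * ?S' w" for w
  proof -
    obtain r where r: "r \<in> span (z ` I)" "\<And>i. i \<in> I \<Longrightarrow> ip (z i) (w - r) = 0"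
        "norm r \<le> C * ?S w" using split[of w] by blast
    \<comment> \<open>If \<open>z k\<close> already lies in the span of the others, then
      \<open>q = 0\<close>, division by zero gives \<open>a = 0\<close>, and \<open>r\<close> is
      kept as projection.\<close>
    define a where "a = ip q w / ip q q"
    define p' where "p' = r + a *\<^sub>R q"
    have "p' \<in> span (z ` insert k I)" unfolding p'_def
      by (intro span_add span_scale q_span span_mono' r)
    moreover have "ip (z i) (w - p') = 0" if "i \<in> insert k I" for i
    proof -
      have I: "ip (z i) (w - p') = 0" if "i \<in> I" for i
        using r(2)[OF that] q_orth[OF span_base, of "z i"] that sym[of "z i" q]
        by (simp add: p'_def l.diff l.add l.scale)
      have "ip (w - p') y = 0" if "y \<in> span (z ` I)" for y
        using that by (induction rule: span_induct_alt)
         (use I in \<open>auto simp: l.zero l.add l.scale sym[of "w - p'"]\<close>)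
      then have 1: "ip p (w - p') = 0" using p sym by simp
      have 2: "ip q (w - p') = 0"
        using pos[of q] q_orth[OF r(1)]
        by (cases "q = 0") (auto simp: p'_def a_def l.diff l.add l.scale sym[of 0] l.zero)
      have "z k = p + q" by (simp add: q_def)
      then have "ip (z k) (w - p') = 0" using 1 2
        by (metis sym l.add add.right_neutral)
      then show ?thesis using I that by auto
    qed
    moreover have "norm p' \<le> (C + N) * ?S' w"
    proof -
      have "\<bar>ip q w\<bar> \<le> \<bar>ip (z k) w\<bar> + M * ?S w"
        using M(2)[of w] unfolding q_def sym[of _ w] l.diff by linarith
      also have "\<dots> \<le> (1 + M) * ?S' w" using M(1) S0[of w]
        by (simp add: S' algebra_simps)
      finally have "\<bar>ip q w\<bar> * (norm q / ip q q) \<le> (1 + M) * ?S' w * (norm q / ip q q)"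
        by (rule mult_right_mono) (use ipq in simp)
      then have "norm (a *\<^sub>R q) \<le> N * ?S' w" using ipq
        by (simp add: a_def N_def mult.commute mult.left_commute)
      moreover have "norm r \<le> C * ?S' w"
        using r(3) mult_left_mono[OF _ C, of "?S w" "?S' w"] by (simp add: S')
      ultimately show ?thesis unfolding p'_def
        using norm_triangle_ineq[of r "a *\<^sub>R q"] by (simp add: distrib_right)
    qed
    ultimately show ?thesis by blast
  qed
  then show ?case using C N by (intro exI[of _ "C + N"]) auto
qed

text \<open>Since the \<open>z i\<close> lie in \<open>W\<close>, both parts of the splitting
  \<open>w = q + p\<close> stay in \<open>W\<close>: coercivity applies to \<open>q\<close>, and
  everything involving \<open>p\<close> is paid for by the penalty.\<close>

lemma coercive_penalised:
  fixes ip :: "'a::real_normed_vector \<Rightarrow> 'a \<Rightarrow> real" and B :: "'a \<Rightarrow> 'a \<Rightarrow> real"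
  assumes ip: "continuous_scalar_product ip" and "finite I" and B: "bounded_bilinear B"
    and W: "subspace W" and z: "\<And>i. i \<in> I \<Longrightarrow> z i \<in> W" and c: "c > 0"
    and coercive: "\<And>w. w \<in> W \<Longrightarrow> (\<And>i. i \<in> I \<Longrightarrow> ip (z i) w = 0) \<Longrightarrow> B w w \<ge> c * (norm w)\<^sup>2"
  shows "\<exists>K\<ge>0. \<exists>c'>0. \<forall>w\<in>W. B w w + K * (\<Sum>i\<in>I. (ip (z i) w)\<^sup>2) \<ge> c' * (norm w)\<^sup>2"
proof -
  interpret B: bounded_bilinear B by fact
  obtain M where M: "M \<ge> 0" "\<And>x y. norm (B x y) \<le> norm x * norm y * M" using B.nonneg_bounded by blast
  obtain C where C: "C \<ge> 0" and split: "\<And>w. \<exists>p\<in>span (z ` I). (\<forall>i\<in>I. ip (z i) (w - p) = 0) \<and>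
      norm p \<le> C * (\<Sum>i\<in>I. \<bar>ip (z i) w\<bar>)"
    using span_orthogonal_split[OF ip \<open>finite I\<close>, of z] by blast
  \<comment> \<open>\<open>2 * M\<^sup>2 / c + M\<close> absorbs the cross terms and
    \<open>B p p\<close>; \<open>c / 2\<close> pays for replacing \<open>norm q\<close> by
    \<open>norm w\<close>. The factor \<open>C\<^sup>2 * card I\<close> in \<open>K\<close> comes
    from the projection bound and Cauchy-Schwarz.\<close>
  define N where "N = c / 2 + 2 * M\<^sup>2 / c + M"
  have N: "N \<ge> 0" using c M by (simp add: N_def)
  define K where "K = N * (C\<^sup>2 * card I)"
  have K: "K \<ge> 0" using N by (simp add: K_def)
  have "B w w + K * (\<Sum>i\<in>I. (ip (z i) w)\<^sup>2) \<ge> c / 4 * (norm w)\<^sup>2" if w: "w \<in> W" for w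
  proof -
    obtain p where p: "p \<in> span (z ` I)" "\<And>i. i \<in> I \<Longrightarrow> ip (z i) (w - p) = 0"
      "norm p \<le> C * (\<Sum>i\<in>I. \<bar>ip (z i) w\<bar>)" using split by blast
    define q where "q = w - p"
    have wpq: "w = q + p" by (simp add: q_def)
    have "span (z ` I) \<subseteq> W" using W z by (intro span_minimal) auto
    then have "q \<in> W" unfolding q_def using W w p by (intro subspace_diff) auto
    then have "B q q \<ge> c * (norm q)\<^sup>2" using p(2) by (intro coercive) (auto simp: q_def)
    moreover have "\<bar>B q p\<bar> \<le> norm q * norm p * M" "\<bar>B p q\<bar> \<le> norm p * norm q * M"
      "\<bar>B p p\<bar> \<le> norm p * norm p * M" using M(2)[of q p] M(2)[of p q] M(2)[of p p] by auto
    moreover have "B w w = B q q + B q p + B p q + B p p"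
      unfolding wpq by (simp add: B.add_left B.add_right)
    ultimately have 1: "B w w \<ge> c * (norm q)\<^sup>2 - 2 * M * norm p * norm q - M * (norm p)\<^sup>2"
      by (simp add: power2_eq_square algebra_simps)
    have "2 * M * norm p * norm q \<le> c / 2 * (norm q)\<^sup>2 + 2 * M\<^sup>2 / c * (norm p)\<^sup>2"
    proof -
      have "0 \<le> (c * norm q - 2 * M * norm p)\<^sup>2 / (2 * c)" using c by simp
      also have "\<dots> = c / 2 * (norm q)\<^sup>2 + 2 * M\<^sup>2 / c * (norm p)\<^sup>2 - 2 * M * norm p * norm q"
        using c by (simp add: power2_eq_square field_simps)
      finally show ?thesis by simp
    qed
    with 1 have 2: "B w w \<ge> c / 2 * (norm q)\<^sup>2 - (2 * M\<^sup>2 / c + M) * (norm p)\<^sup>2"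
      by (simp add: algebra_simps)
    have "(norm w)\<^sup>2 \<le> (norm q + norm p)\<^sup>2" unfolding wpq by (intro power_mono norm_triangle_ineq) simp
    also have "\<dots> \<le> 2 * (norm q)\<^sup>2 + 2 * (norm p)\<^sup>2"
      using sum_squares_bound[of "norm q" "norm p"] by (simp add: power2_sum)
    finally have "c / 4 * (norm w)\<^sup>2 \<le> c / 4 * (2 * (norm q)\<^sup>2 + 2 * (norm p)\<^sup>2)"
      using c by (intro mult_left_mono) auto
    with 2 have 3: "B w w \<ge> c / 4 * (norm w)\<^sup>2 - N * (norm p)\<^sup>2"
      by (simp add: N_def algebra_simps)
    have "(norm p)\<^sup>2 \<le> (C * (\<Sum>i\<in>I. \<bar>ip (z i) w\<bar>))\<^sup>2" using p(3) by (intro power_mono) auto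
    also have "\<dots> \<le> C\<^sup>2 * (card I * (\<Sum>i\<in>I. (ip (z i) w)\<^sup>2))"
      using sum_squared_le_sum_of_squares[of "\<lambda>i. \<bar>ip (z i) w\<bar>" I]
      by (auto simp: power_mult_distrib mult.commute intro!: mult_left_mono)
    finally have "N * (norm p)\<^sup>2 \<le> N * (C\<^sup>2 * (card I * (\<Sum>i\<in>I. (ip (z i) w)\<^sup>2)))"
      using N by (rule mult_left_mono)
    with 3 show ?thesis by (simp add: K_def mult.assoc)
  qed
  then show ?thesis using K c by (intro exI[of _ K] conjI exI[of _ "c / 4"]) auto
qed

text \<open>Differentiability of \<open>V'\<close> at the single point \<open>u\<close> determines
  \<open>V' (u + t w) w\<close> up to \<open>\<epsilon> t\<close> times the squared norm of
  \<open>w\<close>. Subtracting the matching quadratic in \<open>t\<close> from \<open>V\<close>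
  along the segment leaves a nondecreasing \<open>g\<close>, and \<open>g 0 \<le> g 1\<close> is the
  claim.\<close>

lemma second_order_lower_bound:
  fixes V :: "'a::real_normed_vector \<Rightarrow> real" and V' :: "'a \<Rightarrow> 'a \<Rightarrow>\<^sub>L real"
  assumes V: "\<And>x. (V has_derivative blinfun_apply (V' x)) (at x)"
    and V': "(V' has_derivative V'') (at u)" and crit: "V' u = 0" and "\<epsilon> > 0"
  shows "\<exists>r>0. \<forall>w. norm w \<le> r \<longrightarrow> V (u + w) - V u \<ge> (V'' w w - \<epsilon> * (norm w)\<^sup>2) / 2"
proof -
  interpret l: bounded_linear V'' using V' by (rule has_derivative_bounded_linear)
  obtain d where d: "d > 0" "\<And>y. norm (y - u) < d \<Longrightarrow>
      norm (V' y - V' u - V'' (y - u)) \<le> \<epsilon> * norm (y - u)"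
    using V' \<open>\<epsilon> > 0\<close> unfolding has_derivative_at_alt by blast
  have "V (u + w) - V u \<ge> (V'' w w - \<epsilon> * (norm w)\<^sup>2) / 2" if w: "norm w \<le> d / 2" for w
  proof -
    define g where "g t = V (u + t *\<^sub>R w) - t\<^sup>2 * ((V'' w w - \<epsilon> * (norm w)\<^sup>2) / 2)" for t :: real
    have g: "(g has_real_derivative V' (u + t *\<^sub>R w) w - t * (V'' w w - \<epsilon> * (norm w)\<^sup>2)) (at t)" for t
    proof -
      have "((\<lambda>t. V (u + t *\<^sub>R w)) has_derivative (\<lambda>s. V' (u + t *\<^sub>R w) (s *\<^sub>R w))) (at t)"
        by (rule has_derivative_compose[OF _ V, of "\<lambda>t. u + t *\<^sub>R w"])
          (auto intro!: derivative_eq_intros)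
      then have "((\<lambda>t. V (u + t *\<^sub>R w)) has_real_derivative V' (u + t *\<^sub>R w) w) (at t)"
        by (rule has_derivative_imp_has_field_derivative) (simp add: blinfun.scaleR_right)
      then show ?thesis unfolding g_def
        by (auto intro!: derivative_eq_intros simp: field_simps)
    qed
    have "g 0 \<le> g 1"
    proof (rule DERIV_nonneg_imp_nondecreasing[of 0 1 g])
      fix t :: real assume t: "0 \<le> t" "t \<le> 1"
      have nt: "norm (t *\<^sub>R w) < d" using t w d(1) mult_left_le_one_le[of "norm w" t] by simp
      have "norm (V' (u + t *\<^sub>R w) - V'' (t *\<^sub>R w)) \<le> \<epsilon> * norm (t *\<^sub>R w)"
        using d(2)[of "u + t *\<^sub>R w"] nt crit by simp
      then have "norm ((V' (u + t *\<^sub>R w) - V'' (t *\<^sub>R w)) w) \<le> \<epsilon> * norm (t *\<^sub>R w) * norm w"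
        using mult_right_mono[OF _ norm_ge_zero[of w]] norm_blinfun order_trans by blast
      then have "V' (u + t *\<^sub>R w) w - t * V'' w w \<ge> - (\<epsilon> * t * (norm w)\<^sup>2)"
        using t by (simp add: blinfun.diff_left l.scaleR blinfun.scaleR_left power2_eq_square algebra_simps abs_le_iff)
      then have "V' (u + t *\<^sub>R w) w - t * (V'' w w - \<epsilon> * (norm w)\<^sup>2) \<ge> 0" by (simp add: algebra_simps)
      then show "\<exists>y. (g has_real_derivative y) (at t) \<and> 0 \<le> y" using g by blast
    qed simp
    then show ?thesis by (simp add: g_def field_simps)
  qed
  then show ?thesis using d(1) by (intro exI[of _ "d / 2"]) auto
qed

lemma bounded_bilinear_scalar_product:
  fixes ip :: "'a::real_normed_vector \<Rightarrow> 'a \<Rightarrow> real"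
  assumes "continuous_scalar_product ip"
  shows "bounded_bilinear ip"
proof -
  have lin: "linear (ip v)" and sym: "ip v w = ip w v"
    and bd: "\<bar>ip v w\<bar> \<le> norm v * norm w" for v w
    using assms by (auto simp: continuous_scalar_product_def)
  show ?thesis
  proof
    fix a a' b b' :: 'a and r :: real
    show add: "ip a (b + b') = ip a b + ip a b'" for a b b' by (rule linear_add[OF lin])
    show scale: "ip a (r *\<^sub>R b) = r *\<^sub>R ip a b" for a b by (rule linear_scale[OF lin])
    show "ip (a + a') b = ip a b + ip a' b" using add sym by metis
    show "ip (r *\<^sub>R a) b = r *\<^sub>R ip a b" using scale sym by metis
    show "\<exists>K. \<forall>a b. norm (ip a b) \<le> norm a * norm b * K" using bd by (auto intro!: exI[of _ 1])
  qed
qed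

lemma Dblin_eqI: "(f has_derivative f') (at x) \<Longrightarrow> blinfun_apply (Dblin f x) = f'"
  unfolding Dblin_def frechet_derivative_at[symmetric]
  by (simp add: bounded_linear_Blinfun_apply has_derivative_bounded_linear)

lemma has_derivative_Dblin:
  "f differentiable (at x) \<Longrightarrow> (f has_derivative blinfun_apply (Dblin f x)) (at x)"
  using Dblin_eqI frechet_derivative_works by metis

lemma C2D:
  assumes "C2 f"
  shows "(f has_derivative blinfun_apply (Dblin f x)) (at x)"
    and "(Dblin f has_derivative blinfun_apply (Dblin (Dblin f) x)) (at x)"
  using assms by (auto simp: C2_def C1_on_def intro!: has_derivative_Dblin)

lemma constant_along_curve:
  fixes x :: "real \<Rightarrow> 'a::real_normed_vector" and f :: "'a \<Rightarrow> real"
  assumes x: "\<And>t. (x has_vector_derivative x' t) (at t)"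
    and f: "\<And>t. (f has_derivative f' t) (at (x t))"
    and zero: "\<And>t. f' t (x' t) = 0"
  shows "f (x t) = f (x s)"
proof -
  have "((\<lambda>t. f (x t)) has_real_derivative 0) (at t)" for t
  proof -
    interpret f': bounded_linear "f' t" using f by (rule has_derivative_bounded_linear)
    have "((\<lambda>t. f (x t)) has_derivative (\<lambda>h. f' t (h *\<^sub>R x' t))) (at t)"
      using x f unfolding has_vector_derivative_def by (rule has_derivative_compose)
    then show ?thesis by (rule has_derivative_imp_has_field_derivative) (simp add: f'.scaleR zero)
  qed
  then show ?thesis by (intro DERIV_isconst_all[of "\<lambda>t. f (x t)"]) simp
qed

lemma infdist_lessE:
  assumes "infdist v A < r" "A \<noteq> {}"
  obtains a where "a \<in> A" "dist v a < r"
  using assms by (metis bdd_below_image_dist cINF_less_iff infdist_notempty)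

section \<open>The matrix exponential\<close>

text \<open>The norm of \<open>real^'n^'n\<close> is not a Banach algebra norm (\<open>\<parallel>1\<parallel> = sqrt n\<close>); the operator norm is, which makes
  the library facts about \<^const>\<open>exp\<close> applicable.\<close>

typedef (overloaded) ('a::euclidean_space) endo = "UNIV :: ('a \<Rightarrow>\<^sub>L 'a) set" ..

setup_lifting type_definition_endo

instantiation endo :: (euclidean_space) real_normed_algebra_1
begin

lift_definition zero_endo :: "'a endo" is 0 .
lift_definition one_endo :: "'a endo" is id_blinfun .
lift_definition plus_endo :: "'a endo \<Rightarrow> 'a endo \<Rightarrow> 'a endo" is "(+)" .
lift_definition minus_endo :: "'a endo \<Rightarrow> 'a endo \<Rightarrow> 'a endo" is "(-)" .
lift_definition uminus_endo :: "'a endo \<Rightarrow> 'a endo" is uminus .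
lift_definition times_endo :: "'a endo \<Rightarrow> 'a endo \<Rightarrow> 'a endo" is "(o\<^sub>L)" .
lift_definition scaleR_endo :: "real \<Rightarrow> 'a endo \<Rightarrow> 'a endo" is scaleR .
lift_definition norm_endo :: "'a endo \<Rightarrow> real" is norm .

definition dist_endo :: "'a endo \<Rightarrow> 'a endo \<Rightarrow> real"
  where "dist_endo x y = norm (x - y)"
definition sgn_endo :: "'a endo \<Rightarrow> 'a endo"
  where "sgn_endo x = scaleR (inverse (norm x)) x"
definition uniformity_endo :: "('a endo \<times> 'a endo) filter"
  where "uniformity_endo = (INF e\<in>{0<..}. principal {(x, y). dist x y < e})"
definition open_endo :: "'a endo set \<Rightarrow> bool"
  where "open_endo S = (\<forall>x\<in>S. \<forall>\<^sub>F (x', y) in uniformity. x' = x \<longrightarrow> y \<in> S)"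

instance
proof
  fix x y z :: "'a endo" and a b :: real
  show "x + y + z = x + (y + z)" "x + y = y + x" "0 + x = x" "- x + x = 0" "x - y = x + - y"
    "a *\<^sub>R (x + y) = a *\<^sub>R x + a *\<^sub>R y" "(a + b) *\<^sub>R x = a *\<^sub>R x + b *\<^sub>R x"
    "a *\<^sub>R b *\<^sub>R x = (a * b) *\<^sub>R x" "1 *\<^sub>R x = x"
    by (transfer, simp add: algebra_simps)+
  show "x * y * z = x * (y * z)" "(x + y) * z = x * z + y * z" "x * (y + z) = x * y + x * z"
    "1 * x = x" "x * 1 = x" "a *\<^sub>R x * y = a *\<^sub>R (x * y)" "x * a *\<^sub>R y = a *\<^sub>R (x * y)"
    by (transfer, auto intro!: blinfun_eqI simp: blinfun.bilinear_simps)+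
  have "norm (1 :: 'a endo) = 1" by transfer simp
  then show "norm (1 :: 'a endo) = 1" "(0 :: 'a endo) \<noteq> 1"
    by (simp, transfer, metis norm_blinfun_id norm_zero zero_neq_one)
  show "norm x = 0 \<longleftrightarrow> x = 0" "norm (x + y) \<le> norm x + norm y"
    "norm (a *\<^sub>R x) = \<bar>a\<bar> * norm x"
    by (transfer, simp add: norm_triangle_ineq)+
  show "norm (x * y) \<le> norm x * norm y" by transfer (rule norm_blinfun_compose)
qed (rule dist_endo_def sgn_endo_def uniformity_endo_def open_endo_def)+

end

instance endo :: (euclidean_space) banach
proof
  fix X :: "nat \<Rightarrow> 'a endo" assume "Cauchy X"
  have dist: "dist x y = dist (Rep_endo x) (Rep_endo y)" for x y :: "'a endo"
    unfolding dist_norm by transfer simp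
  have "Cauchy (\<lambda>n. Rep_endo (X n))"
    using \<open>Cauchy X\<close> unfolding Cauchy_def dist .
  then obtain L where "(\<lambda>n. Rep_endo (X n)) \<longlonglongrightarrow> L"
    using Cauchy_convergent convergent_def by blast
  then have "X \<longlonglongrightarrow> Abs_endo L"
    by (simp add: tendsto_iff dist Abs_endo_inverse)
  then show "convergent X" by (rule convergentI)
qed

section \<open>Matrices and operators: an algebra isomorphism, bounded in both directions\<close>

definition endo_of_matrix :: "real^'n^'n \<Rightarrow> (real^'n) endo" where
  "endo_of_matrix A = Abs_endo (Blinfun ((*v) A))"

definition matrix_of_endo :: "(real^'n) endo \<Rightarrow> real^'n^'n" where
  "matrix_of_endo x = matrix (blinfun_apply (Rep_endo x))"

lemma Rep_endo_of_matrix: "blinfun_apply (Rep_endo (endo_of_matrix A)) = (*v) A"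
  by (simp add: endo_of_matrix_def Abs_endo_inverse bounded_linear_Blinfun_apply)

lemma matrix_of_endo_of_matrix [simp]: "matrix_of_endo (endo_of_matrix A) = A"
  by (simp add: matrix_of_endo_def Rep_endo_of_matrix)

lemma endo_eqI: "(\<And>v. blinfun_apply (Rep_endo x) v = blinfun_apply (Rep_endo y) v) \<Longrightarrow> x = y"
  by (metis Rep_endo_inject blinfun_eqI)

lemma endo_of_matrix_of_endo [simp]: "endo_of_matrix (matrix_of_endo x) = x"
  by (rule endo_eqI)
    (simp add: Rep_endo_of_matrix matrix_of_endo_def blinfun.bounded_linear_right bounded_linear.linear)

lemma endo_of_matrix_mult: "endo_of_matrix (A ** B) = endo_of_matrix A * endo_of_matrix B"
  by (rule endo_eqI)
    (simp add: Rep_endo_of_matrix times_endo.rep_eq matrix_vector_mul_assoc)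

lemma endo_of_matrix_one: "endo_of_matrix (mat 1) = 1"
  by (rule endo_eqI) (simp add: Rep_endo_of_matrix one_endo.rep_eq)

lemma linear_endo_of_matrix: "linear endo_of_matrix"
  by (rule linearI; rule endo_eqI)
    (simp_all add: Rep_endo_of_matrix plus_endo.rep_eq scaleR_endo.rep_eq blinfun.bilinear_simps
      matrix_vector_mult_add_rdistrib scaleR_matrix_vector_assoc)

lemma bounded_linear_endo_of_matrix: "bounded_linear endo_of_matrix"
  using linear_endo_of_matrix by (rule linear_conv_bounded_linear[THEN iffD1])

lemma matrix_of_endo_mult: "matrix_of_endo (x * y) = matrix_of_endo x ** matrix_of_endo y"
  by (metis endo_of_matrix_mult endo_of_matrix_of_endo matrix_of_endo_of_matrix)

text \<open>Columns are images of axis vectors, so every entry is at most the operator norm.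
  Boundedness in this direction lets the exponential series be mapped back to matrices term by
  term.\<close>

lemma bounded_linear_matrix_of_endo:
  "bounded_linear (matrix_of_endo :: (real^'n) endo \<Rightarrow> real^'n^'n)"
proof (rule bounded_linear_intro)
  fix x y :: "(real^'n) endo" and r :: real
  show "matrix_of_endo (x + y) = matrix_of_endo x + matrix_of_endo y"
    using linear_add[OF linear_endo_of_matrix]
    by (metis endo_of_matrix_of_endo matrix_of_endo_of_matrix)
  show "matrix_of_endo (r *\<^sub>R x) = r *\<^sub>R matrix_of_endo x"
    using linear_scale[OF linear_endo_of_matrix]
    by (metis endo_of_matrix_of_endo matrix_of_endo_of_matrix)
  have "\<bar>matrix_of_endo x $ i $ j\<bar> \<le> norm x" for i j
  proof -
    have "\<bar>matrix_of_endo x $ i $ j\<bar> \<le> norm (Rep_endo x (axis j 1))"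
      unfolding matrix_of_endo_def matrix_def by (simp add: component_le_norm_cart)
    also have "\<dots> \<le> norm x"
      using norm_blinfun[of "Rep_endo x" "axis j 1"] by (simp add: norm_endo.rep_eq)
    finally show ?thesis .
  qed
  then have "norm (matrix_of_endo x $ i) \<le> CARD('n) * norm x" for i
    by (intro order_trans[OF norm_le_l1_cart] order_trans[OF sum_bounded_above]) auto
  then show "norm (matrix_of_endo x) \<le> norm x * (CARD('n) * CARD('n))"
    by (subst norm_vec_def, intro order_trans[OF L2_set_le_sum] order_trans[OF sum_bounded_above])
      (auto simp: algebra_simps)
qed

lemma mexp_eq_exp: "mexp A = matrix_of_endo (exp (endo_of_matrix A))"
proof -
  have pow: "matrix_of_endo (endo_of_matrix A ^ k) = ((**) A ^^ k) (mat 1)" for k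
    by (induction k)
      (simp_all add: matrix_of_endo_mult flip: endo_of_matrix_one)
  interpret bounded_linear "matrix_of_endo :: (real^'n) endo \<Rightarrow> real^'n^'n"
    by (rule bounded_linear_matrix_of_endo)
  have "(\<lambda>k. matrix_of_endo (endo_of_matrix A ^ k /\<^sub>R fact k)) sums
      matrix_of_endo (exp (endo_of_matrix A))"
    by (intro sums exp_converges)
  then have "(\<lambda>k. (1 / fact k) *\<^sub>R ((**) A ^^ k) (mat 1)) sums matrix_of_endo (exp (endo_of_matrix A))"
    by (simp add: scaleR pow inverse_eq_divide)
  then show ?thesis unfolding mexp_def by (rule sums_unique[symmetric])
qed

text \<open>On a ball around \<open>x\<close> the real exponential series at
  \<open>norm x + 1\<close> is a majorant, so the partial sums converge uniformly there.\<close>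

lemma continuous_on_exp_algebra:
  "continuous_on S (exp :: 'a \<Rightarrow> 'a::{real_normed_algebra_1,banach})"
proof -
  have "isCont exp x" for x :: 'a
  proof -
    let ?B = "ball 0 (norm x + 1) :: 'a set"
    have "uniform_limit ?B (\<lambda>n y. \<Sum>k<n. y ^ k /\<^sub>R fact k) (\<lambda>y. \<Sum>k. y ^ k /\<^sub>R fact k) sequentially"
    proof (rule Weierstrass_m_test)
      fix n and y :: 'a assume "y \<in> ?B"
      then have "norm (y ^ n) \<le> (norm x + 1) ^ n"
        by (intro order_trans[OF norm_power_ineq] power_mono) auto
      then show "norm (y ^ n /\<^sub>R fact n) \<le> (norm x + 1) ^ n /\<^sub>R fact n"
        by (simp add: mult_left_mono)
    qed (rule summable_exp_generic)
    then have "continuous_on ?B (\<lambda>y :: 'a. \<Sum>k. y ^ k /\<^sub>R fact k)"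
      by (rule uniform_limit_theorem[rotated]) (auto intro!: continuous_intros always_eventually)
    then show ?thesis
      unfolding exp_def[abs_def] by (rule continuous_on_interior) simp
  qed
  then show ?thesis by (simp add: continuous_at_imp_continuous_on)
qed

lemma continuous_on_mexp: "continuous_on S mexp"
  unfolding mexp_eq_exp[abs_def]
  by (intro bounded_linear.continuous_on[OF bounded_linear_matrix_of_endo]
      continuous_on_compose2[OF continuous_on_exp_algebra[of UNIV]]
      bounded_linear.continuous_on[OF bounded_linear_endo_of_matrix] continuous_on_id) auto

lemma mexp_zero [simp]: "mexp (0 :: real^'n^'n) = mat 1"
  using linear_0[OF linear_endo_of_matrix[where 'a='n]]
  by (simp add: mexp_eq_exp flip: endo_of_matrix_one)

lemma mexp_add_commuting:
  assumes "A ** B = B ** A"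
  shows "mexp (A + B) = mexp A ** mexp B"
proof -
  have "endo_of_matrix A * endo_of_matrix B = endo_of_matrix B * endo_of_matrix A"
    using assms by (simp flip: endo_of_matrix_mult)
  then show ?thesis
    by (simp add: mexp_eq_exp linear_add[OF linear_endo_of_matrix] exp_add_commuting matrix_of_endo_mult)
qed

text \<open>Differentiate the hypothesis at \<open>t = 0\<close>. Used twice, this takes commutation
  from a group to its Lie algebra.\<close>

lemma commute_generator:
  assumes "\<And>t. mexp (t *\<^sub>R A) ** B = B ** mexp (t *\<^sub>R A)"
  shows "A ** B = B ** A"
proof -
  let ?a = "endo_of_matrix A" and ?b = "endo_of_matrix B"
  have "endo_of_matrix (mexp (t *\<^sub>R A) ** B) = endo_of_matrix (B ** mexp (t *\<^sub>R A))" for t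
    by (simp only: assms)
  then have eq: "exp (t *\<^sub>R ?a) * ?b = ?b * exp (t *\<^sub>R ?a)" for t
    by (simp add: mexp_eq_exp endo_of_matrix_mult linear_scale[OF linear_endo_of_matrix])
  have exp: "((\<lambda>t. exp (t *\<^sub>R ?a)) has_vector_derivative ?a) (at 0)"
    using exp_scaleR_has_vector_derivative_right[of ?a 0] by simp
  have "((\<lambda>t. exp (t *\<^sub>R ?a) * ?b) has_vector_derivative ?a * ?b) (at 0)"
    by (rule bounded_linear.has_vector_derivative[OF bounded_linear_mult_left exp])
  moreover have "((\<lambda>t. ?b * exp (t *\<^sub>R ?a)) has_vector_derivative ?b * ?a) (at 0)"
    by (rule bounded_linear.has_vector_derivative[OF bounded_linear_mult_right exp])
  ultimately have "?a * ?b = ?b * ?a"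
    unfolding eq by (rule vector_derivative_unique_at)
  then show ?thesis
    by (metis endo_of_matrix_mult matrix_of_endo_of_matrix)
qed

section \<open>Symmetries and conservation laws\<close>

lemma sum_squares_orthogonal:
  fixes A :: "nat \<Rightarrow> nat \<Rightarrow> real"
  assumes "\<And>j k. j < m \<Longrightarrow> k < m \<Longrightarrow> (\<Sum>i<m. A i j * A i k) = (if j = k then 1 else 0)"
  shows "(\<Sum>i<m. (\<Sum>j<m. A i j * x j)\<^sup>2) = (\<Sum>j<m. (x j)\<^sup>2)"
proof -
  have "(\<Sum>i<m. (\<Sum>j<m. A i j * x j)\<^sup>2) = (\<Sum>i<m. \<Sum>j<m. \<Sum>k<m. (A i j * A i k) * (x j * x k))"
    by (simp add: power2_eq_square sum_product mult_ac)
  also have "\<dots> = (\<Sum>j<m. \<Sum>k<m. (\<Sum>i<m. A i j * A i k) * (x j * x k))"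
    by (simp only: sum_distrib_right) (subst sum.swap, rule sum.cong[OF refl], rule sum.swap)
  also have "\<dots> = (\<Sum>j<m. \<Sum>k<m. (if j = k then 1 else 0) * (x j * x k))"
    using assms by (intro sum.cong refl) auto
  also have "\<dots> = (\<Sum>j<m. (x j)\<^sup>2)"
    by (intro sum.cong refl) (simp add: if_distribR power2_eq_square sum.delta if_distrib cong: if_cong)
  finally show ?thesis .
qed

locale symmetric_hamiltonian_system =
  fixes ip :: "'a::banach \<Rightarrow> 'a \<Rightarrow> real"
    and D :: "'a set"
    and J :: "'a \<Rightarrow> 'a \<Rightarrow>\<^sub>L real"
    and H :: "'a \<Rightarrow> real"
    and \<Phi>H :: "real \<Rightarrow> 'a \<Rightarrow> 'a"
    and G :: "(real^'n^'n) set"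
    and m :: nat
    and e :: "nat \<Rightarrow> real^'n^'n"
    and \<Phi> :: "real^'n^'n \<Rightarrow> 'a \<Rightarrow> 'a"
    and Fam :: "real^'n^'n \<Rightarrow> 'a \<Rightarrow> real"
  assumes ip: "continuous_scalar_product ip"
    and dom: "is_domain D"
    and J: "symplector J"
    and C2_H: "C2 H"
    and flow_H: "hamiltonian_flow D J H \<Phi>H"
    and G: "matrix_lie_group G"
    and basis: "lie_basis G m e"
    and ham: "globally_hamiltonian D J G \<Phi> Fam"
    and equiv: "Ad_star_equivariant G m e \<Phi> Fam"
    and C2_Fam: "j < m \<Longrightarrow> C2 (Fam (e j))"
    and isometry: "\<forall>g\<in>G. linear (\<Phi> g) \<and> (\<forall>v w. ip (\<Phi> g v) (\<Phi> g w) = ip v w) \<and>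
           (\<forall>v. norm (\<Phi> g v) = norm v)"
    and H_inv: "\<forall>g\<in>G. H \<circ> \<Phi> g = H"
begin

sublocale ip: bounded_bilinear ip
  using ip by (rule bounded_bilinear_scalar_product)

sublocale J: bounded_linear J
  using J by (simp add: symplector_def)

lemma ip_commute: "ip v w = ip w v"
  using ip by (simp add: continuous_scalar_product_def)

lemma ip_nonneg: "ip v v \<ge> 0"
  using ip by (cases "v = 0") (auto simp: continuous_scalar_product_def less_imp_le ip.zero_left)

lemma ip_pos: "v \<noteq> 0 \<Longrightarrow> ip v v > 0"
  using ip by (simp add: continuous_scalar_product_def)

lemma ip_le: "ip v w \<le> norm v * norm w"
  using ip by (meson abs_le_D1 continuous_scalar_product_def)

lemma J_antisym: "J v w = - J w v"
  using J unfolding symplector_def by blast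

text \<open>Carries identities from \<open>D\<close>, where derivatives are represented through
  \<open>J\<close>, to all of \<open>E\<close>.\<close>

lemma dense_constant:
  assumes "continuous_on UNIV f" and "\<And>v. v \<in> D \<Longrightarrow> f v = (c :: real)"
  shows "f v = c"
  using assms dom continuous_constant_on_closure[of D f c v] by (simp add: is_domain_def)

lemma D_nonempty: "D \<noteq> {}"
  using dom by (auto simp: is_domain_def)

lemma act_one: "\<Phi> (mat 1) v = v"
  using ham by (simp add: globally_hamiltonian_def group_action_def)

lemma act_mult: "g \<in> G \<Longrightarrow> h \<in> G \<Longrightarrow> \<Phi> (g ** h) v = \<Phi> g (\<Phi> h v)"
  using ham by (simp add: globally_hamiltonian_def group_action_def)

lemma act_continuous: "continuous_on G (\<lambda>g. \<Phi> g v)"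
  using ham by (simp add: globally_hamiltonian_def group_action_def)

lemma one_G: "mat 1 \<in> G"
  using G by (simp add: matrix_lie_group_def)

lemma mult_G: "g \<in> G \<Longrightarrow> h \<in> G \<Longrightarrow> g ** h \<in> G"
  using G by (simp add: matrix_lie_group_def)

lemma inv_G: "g \<in> G \<Longrightarrow> matrix_inv g \<in> G"
  using G by (simp add: matrix_lie_group_def)

lemma inv_cancel:
  assumes "g \<in> G"
  shows "g ** matrix_inv g = mat 1" "matrix_inv g ** g = mat 1"
  using assms G someI_ex[of "\<lambda>h. g ** h = mat 1 \<and> h ** g = mat 1"]
  by (auto simp: matrix_lie_group_def invertible_def matrix_inv_def)

lemma act_inv:
  assumes "g \<in> G"
  shows "\<Phi> g (\<Phi> (matrix_inv g) v) = v" "\<Phi> (matrix_inv g) (\<Phi> g v) = v"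
  using assms by (simp_all add: act_one inv_G inv_cancel flip: act_mult)

lemma act_bounded_linear: "g \<in> G \<Longrightarrow> bounded_linear (\<Phi> g)"
  using isometry
  by (intro bounded_linear_intro[of _ 1]) (auto simp: linear_add linear_scale)

lemma act_ip: "g \<in> G \<Longrightarrow> ip (\<Phi> g v) (\<Phi> g w) = ip v w"
  using isometry by blast

lemma act_norm: "g \<in> G \<Longrightarrow> norm (\<Phi> g v) = norm v"
  using isometry by blast

lemma act_dist:
  assumes "g \<in> G"
  shows "dist (\<Phi> g v) (\<Phi> g w) = dist v w"
  using act_norm[OF assms, of "v - w"] linear_diff[OF bounded_linear.linear[OF act_bounded_linear[OF assms]]]
  by (simp add: dist_norm)

lemma act_D: "g \<in> G \<Longrightarrow> v \<in> D \<Longrightarrow> \<Phi> g v \<in> D"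
  using ham by (auto simp: globally_hamiltonian_def)

lemma act_has_derivative: "g \<in> G \<Longrightarrow> (\<Phi> g has_derivative \<Phi> g) (at v)"
  by (intro bounded_linear_imp_has_derivative act_bounded_linear)

text \<open>Symplecticity concerns derivatives at points of \<open>D\<close>; a bounded linear map
  is its own derivative everywhere, so one point of \<open>D\<close> is enough.\<close>

lemma act_J:
  assumes "g \<in> G"
  shows "J (\<Phi> g v) (\<Phi> g w) = J v w"
proof -
  obtain x where "x \<in> D" using D_nonempty by blast
  then have "J (Dblin (\<Phi> g) x v) (Dblin (\<Phi> g) x w) = J v w"
    using ham assms by (auto simp: globally_hamiltonian_def symplectic_map_def)
  then show ?thesis by (simp add: Dblin_eqI[OF act_has_derivative[OF assms]])
qed

lemma H_act: "g \<in> G \<Longrightarrow> H (\<Phi> g v) = H v"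
  using H_inv by (metis comp_apply)

text \<open>The vector field \<open>X_\<xi>\<close> of the action. Differentiability of the curve is
  known only for \<open>v\<close> in \<open>D\<close>, so the value is used only there.\<close>

abbreviation generator :: "real^'n^'n \<Rightarrow> 'a \<Rightarrow> 'a" where
  "generator \<xi> v \<equiv> vector_derivative (\<lambda>t. \<Phi> (mexp (t *\<^sub>R \<xi>)) v) (at 0)"

lemma mexp_G: "\<xi> \<in> lie_algebra G \<Longrightarrow> mexp (t *\<^sub>R \<xi>) \<in> G"
  by (simp add: lie_algebra_def)

section \<open>One-parameter subgroups as Hamiltonian flows\<close>

context
  fixes \<xi> :: "real^'n^'n"
  assumes \<xi>: "\<xi> \<in> lie_algebra G"
begin

lemma Fam_has_derivative: "(Fam \<xi> has_derivative Dblin (Fam \<xi>) v) (at v)"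
  using ham \<xi> by (intro has_derivative_Dblin) (auto simp: globally_hamiltonian_def C1_on_def)

lemma Dblin_Fam_continuous: "continuous_on UNIV (Dblin (Fam \<xi>))"
  using ham \<xi> by (auto simp: globally_hamiltonian_def C1_on_def)

lemma flow_act: "\<Phi> (mexp ((t + s) *\<^sub>R \<xi>)) v = \<Phi> (mexp (t *\<^sub>R \<xi>)) (\<Phi> (mexp (s *\<^sub>R \<xi>)) v)"
  using ham \<xi> unfolding globally_hamiltonian_def hamiltonian_flow_def by (metis comp_apply)

lemma generator_has_derivative:
  assumes "v \<in> D"
  shows "((\<lambda>t. \<Phi> (mexp (t *\<^sub>R \<xi>)) v) has_vector_derivative generator \<xi> v) (at 0)"
    and J_generator: "J (generator \<xi> v) = Dblin (Fam \<xi>) v"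
proof -
  have sol: "hamilton_solution D J (Fam \<xi>) v (\<lambda>t. \<Phi> (mexp (t *\<^sub>R \<xi>)) v)"
    using ham \<xi> assms by (auto simp: globally_hamiltonian_def hamiltonian_flow_def)
  then show "((\<lambda>t. \<Phi> (mexp (t *\<^sub>R \<xi>)) v) has_vector_derivative generator \<xi> v) (at 0)"
    unfolding hamilton_solution_def using vector_derivative_works by blast
  have "J (generator \<xi> v) = Dblin (Fam \<xi>) (\<Phi> (mexp (0 *\<^sub>R \<xi>)) v)"
    using sol unfolding hamilton_solution_def by blast
  then show "J (generator \<xi> v) = Dblin (Fam \<xi>) v" by (simp add: act_one)
qed

text \<open>The group law shifts time \<open>t\<close> to time 0, which expresses the velocity as
  the generator at the current point.\<close>

lemma flow_act_has_derivative:
  assumes "v \<in> D"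
  shows "((\<lambda>t. \<Phi> (mexp (t *\<^sub>R \<xi>)) v) has_vector_derivative
    generator \<xi> (\<Phi> (mexp (t *\<^sub>R \<xi>)) v)) (at t)"
proof -
  have "\<Phi> (mexp (t *\<^sub>R \<xi>)) v \<in> D" by (intro act_D mexp_G \<xi> assms)
  from generator_has_derivative(1)[OF this]
  have "((\<lambda>s. \<Phi> (mexp ((t + s) *\<^sub>R \<xi>)) v) has_vector_derivative
      generator \<xi> (\<Phi> (mexp (t *\<^sub>R \<xi>)) v)) (at 0)"
    by (simp flip: flow_act add: add.commute)
  then have "((\<lambda>s. \<Phi> (mexp ((t + s) *\<^sub>R \<xi>)) v) has_vector_derivative
      generator \<xi> (\<Phi> (mexp (t *\<^sub>R \<xi>)) v)) (at (t - t))"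
    by simp
  moreover have "((\<lambda>s. s - t) has_vector_derivative 1) (at t)"
    by (auto intro!: derivative_eq_intros)
  ultimately have "((\<lambda>s. \<Phi> (mexp ((t + s) *\<^sub>R \<xi>)) v) \<circ> (\<lambda>s. s - t) has_vector_derivative
      1 *\<^sub>R generator \<xi> (\<Phi> (mexp (t *\<^sub>R \<xi>)) v)) (at t)"
    by (intro vector_diff_chain_at)
  then show ?thesis by (simp add: o_def)
qed

text \<open>By commutation, the orbit curve through \<open>\<Phi> g v\<close> is the image of the
  one through \<open>v\<close> under the bounded linear map \<open>\<Phi> g\<close>.\<close>

lemma generator_act:
  assumes g: "g \<in> G" and comm: "\<And>t. g ** mexp (t *\<^sub>R \<xi>) = mexp (t *\<^sub>R \<xi>) ** g" and v: "v \<in> D"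
  shows "generator \<xi> (\<Phi> g v) = \<Phi> g (generator \<xi> v)"
proof -
  have "\<Phi> (mexp (t *\<^sub>R \<xi>)) (\<Phi> g v) = \<Phi> g (\<Phi> (mexp (t *\<^sub>R \<xi>)) v)" for t
    using comm[of t] g mexp_G[OF \<xi>, of t] by (simp flip: act_mult)
  moreover have "((\<lambda>t. \<Phi> g (\<Phi> (mexp (t *\<^sub>R \<xi>)) v)) has_vector_derivative \<Phi> g (generator \<xi> v)) (at 0)"
    by (rule bounded_linear.has_vector_derivative[OF act_bounded_linear[OF g]
          generator_has_derivative(1)[OF v]])
  ultimately show ?thesis by (simp add: vector_derivative_at)
qed

text \<open>Since \<open>\<Phi>\<^sub>g\<close> is symplectic and commutes with the flow of \<open>F\<^sub>\<xi>\<close>, the function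
  \<open>F\<^sub>\<xi> \<circ> \<Phi>\<^sub>g - F\<^sub>\<xi>\<close> has zero derivative on \<open>D\<close>, hence everywhere.\<close>

lemma Fam_act_const:
  assumes g: "g \<in> G" and comm: "\<And>t. g ** mexp (t *\<^sub>R \<xi>) = mexp (t *\<^sub>R \<xi>) ** g"
  shows "Fam \<xi> (\<Phi> g v) - Fam \<xi> v = Fam \<xi> (\<Phi> g w) - Fam \<xi> w"
proof -
  have on_D: "Dblin (Fam \<xi>) (\<Phi> g x) (\<Phi> g y) - Dblin (Fam \<xi>) x y = 0" if "x \<in> D" for x y
    using that g generator_act[OF g comm that]
    by (simp add: act_J act_D flip: J_generator)
  have cont: "continuous_on UNIV (\<lambda>x. Dblin (Fam \<xi>) (\<Phi> g x) (\<Phi> g y) - Dblin (Fam \<xi>) x y)" for y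
    by (intro continuous_intros continuous_on_compose2[OF Dblin_Fam_continuous] Dblin_Fam_continuous
        bounded_linear.continuous_on[OF act_bounded_linear[OF g]]) auto
  have zero: "Dblin (Fam \<xi>) (\<Phi> g x) (\<Phi> g y) - Dblin (Fam \<xi>) x y = 0" for x y
    by (rule dense_constant[OF cont on_D])
  have "((\<lambda>x. Fam \<xi> (\<Phi> g x) - Fam \<xi> x) has_derivative
      (\<lambda>y. Dblin (Fam \<xi>) (\<Phi> g x) (\<Phi> g y) - Dblin (Fam \<xi>) x y)) (at x)" for x
    by (intro has_derivative_diff Fam_has_derivative
        has_derivative_compose[OF act_has_derivative[OF g] Fam_has_derivative])
  then have "\<exists>c. \<forall>x\<in>UNIV. Fam \<xi> (\<Phi> g x) - Fam \<xi> x = c"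
    unfolding zero by (intro has_derivative_zero_constant) auto
  then show ?thesis by auto
qed

end

section \<open>Conservation laws for the flow of \<open>H\<close>\<close>

lemma flow_H_solution: "v \<in> D \<Longrightarrow> hamilton_solution D J H v (\<lambda>t. \<Phi>H t v)"
  using flow_H by (simp add: hamiltonian_flow_def)

lemma flow_H_unique: "v \<in> D \<Longrightarrow> hamilton_solution D J H v x \<Longrightarrow> \<Phi>H t v = x t"
  using flow_H by (metis hamiltonian_flow_def)

lemma flow_H_zero: "\<Phi>H 0 v = v"
  using flow_H by (simp add: hamiltonian_flow_def)

lemma flow_H_continuous: "continuous_on UNIV (\<lambda>t. \<Phi>H t v)" "continuous_on UNIV (\<Phi>H t)"
  using flow_H by (auto simp: hamiltonian_flow_def)

lemma flow_H_D: "v \<in> D \<Longrightarrow> \<Phi>H t v \<in> D"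
  using flow_H_solution by (simp add: hamilton_solution_def)

lemma flow_H_has_derivative:
  assumes "v \<in> D"
  shows "((\<lambda>t. \<Phi>H t v) has_vector_derivative vector_derivative (\<lambda>t. \<Phi>H t v) (at t)) (at t)"
    and "J (vector_derivative (\<lambda>t. \<Phi>H t v) (at t)) = Dblin H (\<Phi>H t v)"
  using flow_H_solution[OF assms] vector_derivative_works by (auto simp: hamilton_solution_def)

text \<open>Trajectories starting outside \<open>D\<close> are not known to solve any differential
  equation; conservation along them comes from density and continuity of each
  \<open>\<Phi>H t\<close>.\<close>

lemma conserved_if_conserved_on_D:
  assumes f: "\<And>v. (f has_derivative Dblin f v) (at v)"
    and "\<And>v. v \<in> D \<Longrightarrow> f (\<Phi>H t v) = (f v :: real)"
  shows "f (\<Phi>H t v) = f v"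
proof -
  have "continuous_on UNIV f"
    by (intro continuous_at_imp_continuous_on ballI has_derivative_continuous[OF f])
  then have "continuous_on UNIV (\<lambda>v. f (\<Phi>H t v) - f v)"
    by (intro continuous_intros continuous_on_compose2[OF _ flow_H_continuous(2)]) auto
  from dense_constant[OF this, of 0] show ?thesis using assms(2) by simp
qed

lemma H_conserved: "H (\<Phi>H t v) = H v"
proof (rule conserved_if_conserved_on_D[OF C2D(1)[OF C2_H]])
  fix v assume v: "v \<in> D"
  have "H (\<Phi>H t v) = H (\<Phi>H 0 v)"
  proof (rule constant_along_curve[OF flow_H_has_derivative(1)[OF v] C2D(1)[OF C2_H]])
    show "Dblin H (\<Phi>H t v) (vector_derivative (\<lambda>t. \<Phi>H t v) (at t)) = 0" for t
      unfolding flow_H_has_derivative(2)[OF v, symmetric]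
      using J_antisym[of "vector_derivative (\<lambda>t. \<Phi>H t v) (at t)" "vector_derivative (\<lambda>t. \<Phi>H t v) (at t)"] by linarith
  qed
  then show "H (\<Phi>H t v) = H v" by (simp add: flow_H_zero)
qed

lemma H_infinitesimal_symmetry:
  assumes \<xi>: "\<xi> \<in> lie_algebra G" and v: "v \<in> D"
  shows "Dblin H v (generator \<xi> v) = 0"
proof -
  have "((\<lambda>t. H (\<Phi> (mexp (t *\<^sub>R \<xi>)) v)) has_derivative
      (\<lambda>h. Dblin H (\<Phi> (mexp (0 *\<^sub>R \<xi>)) v) (h *\<^sub>R generator \<xi> v))) (at 0)"
    using generator_has_derivative(1)[OF \<xi> v] C2D(1)[OF C2_H] unfolding has_vector_derivative_def
    by (rule has_derivative_compose)
  then have "((\<lambda>t::real. H v) has_derivative (\<lambda>h. Dblin H v (h *\<^sub>R generator \<xi> v))) (at 0)"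
    by (simp add: H_act mexp_G \<xi> act_one)
  then have "(\<lambda>h::real. Dblin H v (h *\<^sub>R generator \<xi> v)) = (\<lambda>h. 0)"
    by (rule has_derivative_unique) simp
  from fun_cong[OF this, of 1] show ?thesis by simp
qed

text \<open>Noether: the symmetry of \<open>H\<close> under the flow of \<open>F\<^sub>\<xi>\<close> and antisymmetry of \<open>J\<close>.\<close>

lemma Fam_conserved:
  assumes \<xi>: "\<xi> \<in> lie_algebra G"
  shows "Fam \<xi> (\<Phi>H t v) = Fam \<xi> v"
proof (rule conserved_if_conserved_on_D[OF Fam_has_derivative[OF \<xi>]])
  fix v assume v: "v \<in> D"
  have "Fam \<xi> (\<Phi>H t v) = Fam \<xi> (\<Phi>H 0 v)"
  proof (rule constant_along_curve[OF flow_H_has_derivative(1)[OF v] Fam_has_derivative[OF \<xi>]])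
    show "Dblin (Fam \<xi>) (\<Phi>H t v) (vector_derivative (\<lambda>t. \<Phi>H t v) (at t)) = 0" for t
      unfolding J_generator[OF \<xi> flow_H_D[OF v], symmetric]
      \<comment> \<open>With \<open>X\<close> the generator and \<open>x'\<close> the velocity:
        \<open>DF x' = J X x' = - J x' X = - DH X = 0\<close>.\<close>
      by (subst J_antisym)
        (simp add: flow_H_has_derivative(2)[OF v] H_infinitesimal_symmetry[OF \<xi> flow_H_D[OF v]])
  qed
  then show "Fam \<xi> (\<Phi>H t v) = Fam \<xi> v" by (simp add: flow_H_zero)
qed

section \<open>Coordinates of the Hamiltonians in the chosen basis\<close>

lemma basis_in: "j < m \<Longrightarrow> e j \<in> lie_algebra G"
  using basis span_base[of "e j" "e ` {..<m}"] by (simp add: lie_basis_def)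

text \<open>Read off from the basis, whose span is the Lie algebra; no product formula for
  exponentials enters.\<close>

lemma subspace_lie_algebra: "subspace (lie_algebra G)"
  using basis subspace_span[of "e ` {..<m}"] by (simp add: lie_basis_def)

lemma lie_expand:
  assumes "\<xi> \<in> lie_algebra G"
  shows "\<xi> = (\<Sum>j<m. coord m e \<xi> j *\<^sub>R e j)"
proof -
  have "(\<Sum>b\<in>e ` {..<m}. representation (e ` {..<m}) \<xi> b *\<^sub>R b) = \<xi>"
    using basis assms by (intro sum_representation_eq) (auto simp: lie_basis_def)
  then show ?thesis
    using basis by (simp add: lie_basis_def sum.reindex coord_def)
qed

lemma Fam_sum:
  assumes "finite A" and "\<And>j. j \<in> A \<Longrightarrow> \<xi> j \<in> lie_algebra G"
  shows "Fam (\<Sum>j\<in>A. c j *\<^sub>R \<xi> j) v = (\<Sum>j\<in>A. c j * Fam (\<xi> j) v)"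
  using assms
proof (induction A)
  case empty
  have "Fam (0 *\<^sub>R 0 + 0 *\<^sub>R 0) v = 0 * Fam 0 v + 0 * Fam 0 v"
    using ham subspace_0[OF subspace_lie_algebra] unfolding globally_hamiltonian_def by blast
  then show ?case by simp
next
  case (insert k A)
  have "(\<Sum>j\<in>A. c j *\<^sub>R \<xi> j) \<in> lie_algebra G"
    using insert by (intro subspace_sum subspace_lie_algebra subspace_scale) auto
  then have "Fam (c k *\<^sub>R \<xi> k + 1 *\<^sub>R (\<Sum>j\<in>A. c j *\<^sub>R \<xi> j)) v =
      c k * Fam (\<xi> k) v + 1 * Fam (\<Sum>j\<in>A. c j *\<^sub>R \<xi> j) v"
    using ham insert.prems unfolding globally_hamiltonian_def by blast
  then show ?case using insert by simp
qed

lemma Fam_expand: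
  assumes "\<xi> \<in> lie_algebra G"
  shows "Fam \<xi> v = (\<Sum>j<m. coord m e \<xi> j * Fam (e j) v)"
  using Fam_sum[of "{..<m}" e "coord m e \<xi>" v] lie_expand[OF assms] basis_in by simp

lemma Dblin_Fam_expand:
  assumes "\<xi> \<in> lie_algebra G"
  shows "Dblin (Fam \<xi>) v = (\<Sum>j<m. coord m e \<xi> j *\<^sub>R Dblin (Fam (e j)) v)"
proof -
  have "(Fam \<xi> has_derivative (\<Sum>j<m. coord m e \<xi> j *\<^sub>R Dblin (Fam (e j)) v)) (at v)"
    unfolding Fam_expand[OF assms, abs_def] using basis_in
    by (auto intro!: derivative_eq_intros Fam_has_derivative simp: blinfun.bilinear_simps fun_eq_iff)
  from Dblin_eqI[OF this] show ?thesis by (simp add: blinfun_apply_inject)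
qed

end

section \<open>Relative equilibria and their stability\<close>

text \<open>Regularity is recorded at \<open>u\<close> alone, where it makes the infinitesimal
  action injective. The gradients and the coercivity are left to the stability lemmas.\<close>

locale constrained_critical_point = symmetric_hamiltonian_system ip D J H \<Phi>H G m e \<Phi> Fam
  for ip :: "'a::banach \<Rightarrow> 'a \<Rightarrow> real" and D J H \<Phi>H
    and G :: "(real^'n^'n) set" and m e \<Phi> Fam +
  fixes \<mu> :: "nat \<Rightarrow> real" and u :: 'a and \<xi> :: "real^'n^'n"
  assumes u_D: "u \<in> D" and u_level: "momentum m e Fam u = \<mu>"
    and orthogonal: "g \<in> stabilizer G m e \<mu> \<Longrightarrow> Ad_star_orthogonal m e g"
    and regular: "range (D_momentum m e Fam u) = {..<m} \<rightarrow>\<^sub>E UNIV"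
    and \<xi>: "\<xi> \<in> lie_algebra (stabilizer G m e \<mu>)"
    and critical: "Dblin (lagrangian m e Fam H \<xi>) u = 0"
    and commutative: "g \<in> stabilizer G m e \<mu> \<Longrightarrow> h \<in> stabilizer G m e \<mu> \<Longrightarrow> g ** h = h ** g"
begin

section \<open>The stabiliser and its Lie algebra\<close>

abbreviation K where "K \<equiv> stabilizer G m e \<mu>"

lemma Fam_u: "j < m \<Longrightarrow> Fam (e j) u = \<mu> j"
  using u_level by (auto simp: momentum_def)

lemma momentum_act: "g \<in> G \<Longrightarrow> momentum m e Fam (\<Phi> g v) = Ad_star m e g (momentum m e Fam v)"
  using equiv by (simp add: Ad_star_equivariant_def)

lemma K_G: "g \<in> K \<Longrightarrow> g \<in> G"
  by (simp add: stabilizer_def)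

text \<open>By equivariance, fixing \<open>\<mu>\<close> means keeping \<open>u\<close> in its level
  set. The group laws of \<open>K\<close> are thus inherited from the action on \<open>E\<close>,
  without computing with compositions of \<open>Ad_star\<close>.\<close>

lemma mem_K: "g \<in> K \<longleftrightarrow> g \<in> G \<and> momentum m e Fam (\<Phi> g u) = \<mu>"
  by (auto simp: stabilizer_def momentum_act u_level)

lemma K_one: "mat 1 \<in> K"
  by (simp add: mem_K one_G act_one u_level)

lemma K_mult:
  assumes "g \<in> K" "h \<in> K"
  shows "g ** h \<in> K"
proof -
  have "momentum m e Fam (\<Phi> (g ** h) u) = Ad_star m e g (momentum m e Fam (\<Phi> h u))"
    using assms by (simp add: act_mult K_G momentum_act[of g])
  also have "\<dots> = \<mu>" using assms mem_K[of h] by (simp add: stabilizer_def)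
  finally show ?thesis using assms mem_K[of "g ** h"] by (simp add: mult_G K_G)
qed

lemma K_inv:
  assumes "g \<in> K"
  shows "matrix_inv g \<in> K"
proof -
  have g: "g \<in> G" "momentum m e Fam (\<Phi> g u) = \<mu>" using assms by (auto simp: mem_K)
  have "momentum m e Fam (\<Phi> (matrix_inv g) u) = Ad_star m e (matrix_inv g) (momentum m e Fam (\<Phi> g u))"
    using g by (simp add: momentum_act inv_G u_level)
  also have "\<dots> = momentum m e Fam (\<Phi> (matrix_inv g) (\<Phi> g u))"
    by (rule momentum_act[OF inv_G[OF g(1)], symmetric])
  finally show ?thesis using g by (simp add: mem_K inv_G act_inv u_level)
qed

lemma k_mexp: "\<eta> \<in> lie_algebra K \<Longrightarrow> mexp (t *\<^sub>R \<eta>) \<in> K"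
  by (simp add: lie_algebra_def)

lemma k_mexp1: "\<eta> \<in> lie_algebra K \<Longrightarrow> mexp \<eta> \<in> K"
  using k_mexp[of \<eta> 1] by simp

lemma k_g: "\<eta> \<in> lie_algebra K \<Longrightarrow> \<eta> \<in> lie_algebra G"
  using K_G by (auto simp: lie_algebra_def)

lemma k_scale: "\<eta> \<in> lie_algebra K \<Longrightarrow> t *\<^sub>R \<eta> \<in> lie_algebra K"
  by (simp add: lie_algebra_def)

lemma k_commute:
  assumes "\<eta> \<in> lie_algebra K" "\<zeta> \<in> lie_algebra K"
  shows "\<eta> ** \<zeta> = \<zeta> ** \<eta>"
proof -
  have "mexp (s *\<^sub>R \<zeta>) ** \<eta> = \<eta> ** mexp (s *\<^sub>R \<zeta>)" for s
    by (rule commute_generator[symmetric]) (intro commutative k_mexp assms)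
  then show ?thesis by (rule commute_generator[symmetric])
qed

lemma k_mexp_add:
  assumes "\<eta> \<in> lie_algebra K" "\<zeta> \<in> lie_algebra K"
  shows "mexp (\<eta> + \<zeta>) = mexp \<eta> ** mexp \<zeta>"
  using assms by (intro mexp_add_commuting k_commute)

text \<open>Closure under addition rests on commutativity: the exponential of a sum is the product
  of the exponentials, hence in \<open>K\<close>.\<close>

lemma subspace_k: "subspace (lie_algebra K)"
proof (rule subspaceI)
  show "0 \<in> lie_algebra K" by (simp add: lie_algebra_def K_one)
  show "\<eta> + \<zeta> \<in> lie_algebra K" if "\<eta> \<in> lie_algebra K" "\<zeta> \<in> lie_algebra K" for \<eta> \<zeta>
    using that k_mexp_add[OF k_scale k_scale, OF that] K_mult[OF k_mexp k_mexp, OF that]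
    by (simp add: lie_algebra_def scaleR_add_right)
qed (rule k_scale)

section \<open>Invariance of the penalty and of the Lagrangian\<close>

lemma penalty_act:
  assumes g: "g \<in> K"
  shows "(\<Sum>j<m. (Fam (e j) (\<Phi> g v) - \<mu> j)\<^sup>2) = (\<Sum>j<m. (Fam (e j) v - \<mu> j)\<^sup>2)"
proof -
  define A where "A i j = coord m e (Ad (matrix_inv g) (e i)) j" for i j
  have entry: "Ad_star_entry m e g i j = A i j" if "i < m" "j < m" for i j
  proof -
    have "Ad_star_entry m e g i j = (\<Sum>k<m. if k = j then A i k else 0)"
      using that(1) by (auto simp: Ad_star_entry_def Ad_star_def pairing_def A_def
        simp del: sum.delta sum.delta' intro!: sum.cong)
    then show ?thesis using that(2) by simp
  qed
  have F: "Fam (e i) (\<Phi> g v) = (\<Sum>j<m. A i j * Fam (e j) v)" if "i < m" for i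
    using that fun_cong[OF momentum_act[OF K_G[OF g]], of v i]
    by (simp add: momentum_def Ad_star_def pairing_def A_def)
  have \<mu>: "\<mu> i = (\<Sum>j<m. A i j * \<mu> j)" if "i < m" for i
  proof -
    have "Ad_star m e g \<mu> i = \<mu> i" using g by (simp add: stabilizer_def)
    then show ?thesis using that by (simp add: Ad_star_def pairing_def A_def)
  qed
  \<comment> \<open>As \<open>g\<close> fixes \<open>\<mu>\<close>, the momentum and
    \<open>\<mu>\<close> are transformed by the same matrix \<open>A\<close>, so their difference is
    merely rotated.\<close>
  have "Fam (e i) (\<Phi> g v) - \<mu> i = (\<Sum>j<m. A i j * (Fam (e j) v - \<mu> j))" if "i < m" for i
    using F[OF that] \<mu>[OF that] by (simp add: right_diff_distrib sum_subtractf)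
  then have "(\<Sum>i<m. (Fam (e i) (\<Phi> g v) - \<mu> i)\<^sup>2) = (\<Sum>i<m. (\<Sum>j<m. A i j * (Fam (e j) v - \<mu> j))\<^sup>2)"
    by simp
  also have "\<dots> = (\<Sum>j<m. (Fam (e j) v - \<mu> j)\<^sup>2)"
    using orthogonal[OF g] entry
    by (intro sum_squares_orthogonal) (simp add: Ad_star_orthogonal_def)
  finally show ?thesis .
qed

abbreviation L where "L \<equiv> lagrangian m e Fam H \<xi>"

lemma L_eq: "L = (\<lambda>v. H v - Fam \<xi> v)"
  using Fam_expand[OF k_g[OF \<xi>]]
  by (auto simp: lagrangian_def pairing_def momentum_def fun_eq_iff)

lemma L_has_derivative: "(L has_derivative Dblin L v) (at v)"
  and Dblin_L: "Dblin L v = Dblin H v - Dblin (Fam \<xi>) v"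
proof -
  have d: "(L has_derivative (Dblin H v - Dblin (Fam \<xi>) v)) (at v)"
    unfolding L_eq
    by (auto intro!: derivative_eq_intros C2D(1)[OF C2_H] Fam_has_derivative[OF k_g[OF \<xi>]]
        simp: blinfun.diff_left)
  show eq: "Dblin L v = Dblin H v - Dblin (Fam \<xi>) v"
    using Dblin_eqI[OF d] by (simp add: blinfun_apply_inject)
  show "(L has_derivative Dblin L v) (at v)" using d by (simp add: eq)
qed

text \<open>Second differentiability is assumed for the components \<open>Fam (e j)\<close>, so
  \<open>Fam \<xi>\<close> is first expanded in the basis.\<close>

lemma Dblin_L_has_derivative: "(Dblin L has_derivative Dblin (Dblin L) v) (at v)"
proof (rule has_derivative_Dblin)
  have eq: "Dblin L = (\<lambda>v. Dblin H v - (\<Sum>j<m. coord m e \<xi> j *\<^sub>R Dblin (Fam (e j)) v))"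
    using Dblin_Fam_expand[OF k_g[OF \<xi>]] by (auto simp: Dblin_L fun_eq_iff)
  have "((\<lambda>v. Dblin H v - (\<Sum>j<m. coord m e \<xi> j *\<^sub>R Dblin (Fam (e j)) v)) has_derivative
      (\<lambda>w. Dblin (Dblin H) v w - (\<Sum>j<m. coord m e \<xi> j *\<^sub>R Dblin (Dblin (Fam (e j))) v w))) (at v)"
    by (intro has_derivative_diff has_derivative_sum has_derivative_scaleR_right C2D(2) C2_H C2_Fam) auto
  then show "Dblin L differentiable (at v)"
    unfolding eq by (rule differentiableI)
qed

text \<open>\<open>Fam \<xi>\<close> changes under \<open>\<Phi> g\<close> by a constant only; at
  \<open>u\<close> this constant is 0, because \<open>\<Phi> g u\<close> has the same momentum
  \<open>\<mu>\<close>.\<close>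

lemma L_act:
  assumes g: "g \<in> K"
  shows "L (\<Phi> g v) = L v"
proof -
  have "Fam (e j) (\<Phi> g u) = \<mu> j" if "j < m" for j
    using g that by (auto simp: mem_K momentum_def)
  then have "Fam \<xi> (\<Phi> g u) = Fam \<xi> u"
    by (simp add: Fam_expand[OF k_g[OF \<xi>]] Fam_u)
  then have "Fam \<xi> (\<Phi> g v) = Fam \<xi> v"
    using Fam_act_const[OF k_g[OF \<xi>] K_G[OF g] commutative[OF g k_mexp[OF \<xi>]], of v u] by simp
  then show ?thesis by (simp add: L_eq H_act K_G[OF g])
qed

section \<open>Motion on the orbit of \<open>u\<close>\<close>

lemma critical_orbit:
  assumes g: "g \<in> K"
  shows "Dblin H (\<Phi> g u) = Dblin (Fam \<xi>) (\<Phi> g u)"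
proof -
  have "((\<lambda>v. L (\<Phi> g v)) has_derivative (\<lambda>w. Dblin L (\<Phi> g u) (\<Phi> g w))) (at u)"
    by (rule has_derivative_compose[OF act_has_derivative[OF K_G[OF g]] L_has_derivative])
  then have "(L has_derivative (\<lambda>w. Dblin L (\<Phi> g u) (\<Phi> g w))) (at u)"
    by (simp add: L_act[OF g])
  then have "(\<lambda>w. Dblin L (\<Phi> g u) (\<Phi> g w)) = Dblin L u"
    using L_has_derivative by (rule has_derivative_unique)
  then have "Dblin L (\<Phi> g u) (\<Phi> g w) = 0" for w
    using critical by (metis blinfun.zero_left)
  \<comment> \<open>Every \<open>w\<close> is an image under \<open>\<Phi> g\<close>.\<close>
  then have "Dblin L (\<Phi> g u) w = 0" for w
    using act_inv(1)[OF K_G[OF g], of w] by metis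
  then show ?thesis
    by (intro blinfun_eqI) (simp add: Dblin_L blinfun.diff_left)
qed

text \<open>The one-parameter curve solves Hamilton's equation for \<open>Fam \<xi>\<close>. Along
  the orbit \<open>H\<close> and \<open>Fam \<xi>\<close> have equal derivatives, so it also solves
  the equation for \<open>H\<close>, and uniqueness applies.\<close>

lemma flow_H_orbit:
  assumes g: "g \<in> K"
  shows "\<Phi>H t (\<Phi> g u) = \<Phi> (mexp (t *\<^sub>R \<xi>)) (\<Phi> g u)"
proof (rule flow_H_unique)
  show D: "\<Phi> g u \<in> D" by (intro act_D K_G g u_D)
  have "Dblin H (\<Phi> (mexp (t *\<^sub>R \<xi>)) (\<Phi> g u)) = Dblin (Fam \<xi>) (\<Phi> (mexp (t *\<^sub>R \<xi>)) (\<Phi> g u))" for t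
    using critical_orbit[OF K_mult[OF k_mexp[OF \<xi>] g]] by (simp add: act_mult K_G k_mexp \<xi> g)
  moreover have "\<Phi> (mexp (t *\<^sub>R \<xi>)) (\<Phi> g u) \<in> D" for t
    by (intro act_D D K_G k_mexp \<xi>)
  moreover have "(\<lambda>t. \<Phi> (mexp (t *\<^sub>R \<xi>)) (\<Phi> g u)) differentiable (at t)" for t
    by (rule differentiableI_vector[OF flow_act_has_derivative[OF k_g[OF \<xi>] D]])
  moreover have "vector_derivative (\<lambda>t. \<Phi> (mexp (t *\<^sub>R \<xi>)) (\<Phi> g u)) (at t) =
      generator \<xi> (\<Phi> (mexp (t *\<^sub>R \<xi>)) (\<Phi> g u))" for t
    by (rule vector_derivative_at[OF flow_act_has_derivative[OF k_g[OF \<xi>] D]])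
  ultimately show "hamilton_solution D J H (\<Phi> g u) (\<lambda>t. \<Phi> (mexp (t *\<^sub>R \<xi>)) (\<Phi> g u))"
    by (simp add: hamilton_solution_def act_one J_generator[OF k_g[OF \<xi>]])
qed

lemma flow_H_orbit_mem:
  assumes "v \<in> orbit \<Phi> K u"
  shows "\<Phi>H t v \<in> orbit \<Phi> K v"
proof -
  obtain g where "g \<in> K" "v = \<Phi> g u" using assms by (auto simp: orbit_def)
  then have "\<Phi>H t v = \<Phi> (mexp (t *\<^sub>R \<xi>)) v" by (simp add: flow_H_orbit)
  then show ?thesis using k_mexp[OF \<xi>] by (auto simp: orbit_def)
qed

lemma orbit_eq:
  assumes "v \<in> orbit \<Phi> K u"
  shows "orbit \<Phi> K v = orbit \<Phi> K u"
proof -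
  obtain g where g: "g \<in> K" "v = \<Phi> g u" using assms by (auto simp: orbit_def)
  have "\<Phi> h v \<in> orbit \<Phi> K u" if "h \<in> K" for h
    using that g K_mult[of h g] by (auto simp: orbit_def act_mult K_G intro!: exI[of _ "h ** g"])
  moreover have "\<Phi> h u \<in> orbit \<Phi> K v" if "h \<in> K" for h
    using that g K_mult[OF that K_inv[OF g(1)]]
    by (auto simp: orbit_def act_mult K_G K_inv act_inv intro!: exI[of _ "h ** matrix_inv g"])
  ultimately show ?thesis by (auto simp: orbit_def)
qed

section \<open>Local injectivity of the orbit parametrisation\<close>

lemma generator_inj:
  assumes \<eta>: "\<eta> \<in> lie_algebra G" and "generator \<eta> u = 0"
  shows "\<eta> = 0"
proof -
  have zero: "(\<Sum>j<m. coord m e \<eta> j * Dblin (Fam (e j)) u w) = 0" for w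
  proof -
    have "Dblin (Fam \<eta>) u w = 0"
      using J_generator[OF \<eta> u_D] assms(2) by (simp add: J.zero flip: J_generator)
    then show ?thesis by (simp add: Dblin_Fam_expand[OF \<eta>] blinfun.sum_left blinfun.scaleR_left)
  qed
  \<comment> \<open>Surjectivity of the momentum derivative yields a \<open>w\<close> whose image is
    the coordinate vector of \<open>\<eta>\<close>; for this \<open>w\<close> the vanishing sum is a
    sum of squares.\<close>
  have "restrict (coord m e \<eta>) {..<m} \<in> range (D_momentum m e Fam u)"
    unfolding regular by auto
  then obtain w where "restrict (coord m e \<eta>) {..<m} = D_momentum m e Fam u w" by blast
  then have "coord m e \<eta> j = Dblin (Fam (e j)) u w" if "j < m" for j
    using that by (metis (no_types, lifting) D_momentum_def lessThan_iff restrict_apply')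
  with zero[of w] have "(\<Sum>j<m. (coord m e \<eta> j)\<^sup>2) = 0" by (simp add: power2_eq_square)
  then have "coord m e \<eta> j = 0" if "j < m" for j
    using that by (simp add: sum_nonneg_eq_0_iff)
  then show ?thesis using lie_expand[OF \<eta>] by simp
qed

text \<open>Parametrises the part of the orbit near \<open>u\<close> by the Lie algebra of
  \<open>K\<close>, a normed space with compact balls. Commutativity of \<open>K\<close> turns
  addition of parameters into the action.\<close>

definition curve :: "real^'n^'n \<Rightarrow> 'a" where
  "curve \<eta> = \<Phi> (mexp \<eta>) u"

lemma curve_continuous: "continuous_on (lie_algebra K) curve"
  unfolding curve_def[abs_def]
  by (rule continuous_on_compose2[OF act_continuous continuous_on_mexp]) (auto simp: K_G k_mexp1)

lemma curve_zero [simp]: "curve 0 = u"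
  by (simp add: curve_def act_one)

lemma curve_add:
  "\<eta> \<in> lie_algebra K \<Longrightarrow> \<zeta> \<in> lie_algebra K \<Longrightarrow> curve (\<eta> + \<zeta>) = \<Phi> (mexp \<eta>) (curve \<zeta>)"
  by (simp add: curve_def k_mexp_add act_mult K_G k_mexp1)

lemma curve_multiple:
  assumes \<eta>: "\<eta> \<in> lie_algebra K" and "curve \<eta> = u"
  shows "curve (real k *\<^sub>R \<eta>) = u"
proof (induction k)
  case (Suc k)
  have "real (Suc k) *\<^sub>R \<eta> = \<eta> + real k *\<^sub>R \<eta>" by (simp add: algebra_simps)
  then show ?case
    using curve_add[OF \<eta> k_scale[OF \<eta>]] Suc assms(2) by (simp add: curve_def)
qed simp

text \<open>A sequence of small stabilising elements would, after taking multiples, accumulate at a whole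
  stabilising one-parameter subgroup, contradicting regularity.\<close>

lemma curve_no_small_period:
  "\<exists>\<rho>>0. \<forall>\<eta>\<in>lie_algebra K. norm \<eta> \<le> \<rho> \<longrightarrow> curve \<eta> = u \<longrightarrow> \<eta> = 0"
proof (rule ccontr)
  assume contra: "\<not> ?thesis"
  have "\<exists>\<eta>. \<eta> \<in> lie_algebra K \<and> norm \<eta> \<le> 1 / real (Suc n) \<and> curve \<eta> = u \<and> \<eta> \<noteq> 0" for n
  proof -
    have "1 / real (Suc n) > 0" by simp
    then show ?thesis using contra by blast
  qed
  then obtain \<eta> where \<eta>: "\<And>n. \<eta> n \<in> lie_algebra K" "\<And>n. norm (\<eta> n) \<le> 1 / real (Suc n)"
    "\<And>n. curve (\<eta> n) = u" "\<And>n. \<eta> n \<noteq> 0" by metis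
  define \<zeta> where "\<zeta> n = \<eta> n /\<^sub>R norm (\<eta> n)" for n
  have "compact (lie_algebra K \<inter> sphere 0 1)"
    by (intro closed_Int_compact closed_subspace subspace_k compact_sphere)
  moreover have "\<zeta> n \<in> lie_algebra K \<inter> sphere 0 1" for n
    unfolding \<zeta>_def using k_scale[OF \<eta>(1)] \<eta>(4) by simp
  ultimately obtain \<theta> f where \<theta>: "\<theta> \<in> lie_algebra K" "norm \<theta> = 1" and f: "strict_mono f"
    and lim: "(\<zeta> \<circ> f) \<longlonglongrightarrow> \<theta>"
    unfolding compact_def by (metis IntE dist_0_norm mem_sphere)
  have pos: "curve (s *\<^sub>R \<theta>) = u" if "s \<ge> 0" for s
  proof -
    \<comment> \<open>The multiple \<open>k n\<close> of the small period \<open>\<eta> n\<close>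
      has length within \<open>norm (\<eta> n)\<close> of \<open>s\<close>, so the multiples
      converge to \<open>s *\<^sub>R \<theta>\<close> along the subsequence while the curve stays at
      \<open>u\<close>.\<close>
    define k where "k n = nat \<lfloor>s / norm (\<eta> n)\<rfloor>" for n
    have k: "\<bar>real (k n) * norm (\<eta> n) - s\<bar> \<le> norm (\<eta> n)" for n
    proof -
      have "real (k n) \<le> s / norm (\<eta> n)" "s / norm (\<eta> n) < real (k n) + 1"
        using that unfolding k_def by (auto simp: of_nat_nat)
      then show ?thesis using \<eta>(4)[of n] by (simp add: field_simps abs_le_iff)
    qed
    have "(\<lambda>n. real (k n) * norm (\<eta> n) - s) \<longlonglongrightarrow> 0"
    proof (rule Lim_null_comparison)
      show "\<forall>\<^sub>F n in sequentially. norm (real (k n) * norm (\<eta> n) - s) \<le> 1 / real (Suc n)"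
        using order_trans[OF k \<eta>(2)] by simp
    qed (rule LIMSEQ_Suc[OF lim_const_over_n])
    then have "(\<lambda>n. real (k n) * norm (\<eta> n)) \<longlonglongrightarrow> s" by (rule LIM_zero_cancel)
    then have "(\<lambda>n. real (k (f n)) * norm (\<eta> (f n))) \<longlonglongrightarrow> s"
      using LIMSEQ_subseq_LIMSEQ[OF _ f] by (fastforce simp: o_def)
    with lim have "(\<lambda>n. (real (k (f n)) * norm (\<eta> (f n))) *\<^sub>R \<zeta> (f n)) \<longlonglongrightarrow> s *\<^sub>R \<theta>"
      unfolding o_def by (intro tendsto_scaleR)
    moreover have "(real (k n) * norm (\<eta> n)) *\<^sub>R \<zeta> n = real (k n) *\<^sub>R \<eta> n" for n
      using \<eta>(4)[of n] by (simp add: \<zeta>_def)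
    ultimately have "(\<lambda>n. real (k (f n)) *\<^sub>R \<eta> (f n)) \<longlonglongrightarrow> s *\<^sub>R \<theta>"
      by simp
    from continuous_on_tendsto_compose[OF curve_continuous this]
    have "(\<lambda>n. curve (real (k (f n)) *\<^sub>R \<eta> (f n))) \<longlonglongrightarrow> curve (s *\<^sub>R \<theta>)"
      by (simp add: k_scale \<theta> \<eta>)
    then have "(\<lambda>n::nat. u) \<longlonglongrightarrow> curve (s *\<^sub>R \<theta>)"
      by (simp add: curve_multiple \<eta>)
    then show ?thesis by (simp add: LIMSEQ_const_iff)
  qed
  have "curve (s *\<^sub>R \<theta>) = u" for s
  proof (cases "s \<ge> 0")
    case False
    \<comment> \<open>For negative \<open>s\<close>, the point \<open>u\<close> is rewritten as the
      curve at \<open>- s\<close>; the two parameters then cancel.\<close>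
    have "curve (s *\<^sub>R \<theta>) = \<Phi> (mexp (s *\<^sub>R \<theta>)) (curve ((- s) *\<^sub>R \<theta>))"
      using pos[of "- s"] False by (simp add: curve_def)
    also have "\<dots> = curve (s *\<^sub>R \<theta> + (- s) *\<^sub>R \<theta>)"
      by (rule curve_add[symmetric]; rule k_scale[OF \<theta>(1)])
    finally show ?thesis by simp
  qed (rule pos)
  then have "generator \<theta> u = 0"
    by (simp add: curve_def[symmetric])
  then have "\<theta> = 0" by (rule generator_inj[OF k_g[OF \<theta>(1)]])
  with \<theta>(2) show False by simp
qed

section \<open>Moving nearby points into the normal slice\<close>

lemma ip_diff_lower: "ip (a - b) (a - b) \<ge> ip a a / 2 - ip b b"
proof -
  have "0 \<le> ip (a - 2 *\<^sub>R b) (a - 2 *\<^sub>R b)" by (rule ip_nonneg)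
  then show ?thesis
    using ip_commute[of b a]
    by (simp add: ip.diff_left ip.diff_right ip.scaleR_left ip.scaleR_right)
qed

abbreviation normal_space :: "'a set" where
  "normal_space \<equiv> ip_orth ip (tangent_orbit \<Phi> K u)"

lemma normal_spaceI:
  "(\<And>\<eta>. \<eta> \<in> lie_algebra K \<Longrightarrow> ip w (generator \<eta> u) = 0) \<Longrightarrow> w \<in> normal_space"
  by (auto simp: ip_orth_def tangent_orbit_def)

lemma subspace_normal_space: "subspace normal_space"
  by (rule subspaceI) (auto simp: ip_orth_def ip.zero_left ip.add_left ip.scaleR_left)

text \<open>The group element is found by minimising the \<open>ip\<close>-distance from \<open>v\<close> to the local orbit
  \<open>{curve \<eta> | norm \<eta> \<le> \<rho>}\<close>: for \<open>v\<close> close to \<open>u\<close> the minimum is interior, and the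
  first-order condition there is orthogonality.\<close>

lemma slice:
  assumes "R > 0"
  shows "\<exists>r>0. \<forall>v. dist v u < r \<longrightarrow> (\<exists>g\<in>K. norm (\<Phi> g v - u) \<le> R \<and> \<Phi> g v - u \<in> normal_space)"
proof -
  obtain \<rho>\<^sub>0 where \<rho>\<^sub>0: "\<rho>\<^sub>0 > 0" "\<And>\<eta>. \<eta> \<in> lie_algebra K \<Longrightarrow> norm \<eta> \<le> \<rho>\<^sub>0 \<Longrightarrow> curve \<eta> = u \<Longrightarrow> \<eta> = 0"
    using curve_no_small_period by blast
  have "\<exists>d>0. \<forall>\<eta>\<in>lie_algebra K. dist \<eta> 0 < d \<longrightarrow> dist (curve \<eta>) (curve 0) < R / 2"
    using curve_continuous subspace_0[OF subspace_k] \<open>R > 0\<close>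
    unfolding continuous_on_iff by (meson half_gt_zero)
  then obtain d where d: "d > 0" "\<And>\<eta>. \<eta> \<in> lie_algebra K \<Longrightarrow> norm \<eta> < d \<Longrightarrow> dist (curve \<eta>) u < R / 2"
    by auto
  \<comment> \<open>\<open>\<rho>\<^sub>0\<close> keeps the curve away from \<open>u\<close> on the
    sphere of radius \<open>\<rho>\<close>; \<open>d / 2\<close> keeps it within
    \<open>R / 2\<close> of \<open>u\<close> on the whole ball.\<close>
  define \<rho> where "\<rho> = min \<rho>\<^sub>0 (d / 2)"
  have \<rho>: "\<rho> > 0" "\<rho> \<le> \<rho>\<^sub>0" "\<rho> < d" using \<rho>\<^sub>0 d by (auto simp: \<rho>_def)
  let ?B = "lie_algebra K \<inter> cball 0 \<rho>" and ?S = "lie_algebra K \<inter> sphere 0 \<rho>"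
  have cont: "continuous_on A (\<lambda>\<eta>. ip (curve \<eta> - v) (curve \<eta> - v))" if "A \<subseteq> lie_algebra K" for A v
    using continuous_on_subset[OF curve_continuous that] by (intro ip.continuous_on continuous_intros)
  have "compact ?S" "compact ?B"
    by (intro closed_Int_compact closed_subspace subspace_k compact_sphere compact_cball)+
  have "\<exists>\<kappa>>0. \<forall>\<eta>\<in>?S. \<kappa> \<le> ip (curve \<eta> - u) (curve \<eta> - u)"
  \<comment> \<open>The sphere is empty when the Lie algebra of \<open>K\<close> is trivial; any
    positive \<open>\<kappa>\<close> then serves.\<close>
  proof (cases "?S = {}")
    case False
    then obtain \<eta> where \<eta>: "\<eta> \<in> ?S"
      "\<forall>\<zeta>\<in>?S. ip (curve \<eta> - u) (curve \<eta> - u) \<le> ip (curve \<zeta> - u) (curve \<zeta> - u)"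
      using continuous_attains_inf[OF \<open>compact ?S\<close> _ cont] by blast
    then have "curve \<eta> - u \<noteq> 0" using \<rho>\<^sub>0(2)[of \<eta>] \<rho> by auto
    then show ?thesis using ip_pos \<eta>(2) by blast
  qed (auto intro: exI[of _ 1])
  then obtain \<kappa> where \<kappa>: "\<kappa> > 0" "\<And>\<eta>. \<eta> \<in> ?S \<Longrightarrow> \<kappa> \<le> ip (curve \<eta> - u) (curve \<eta> - u)" by blast
  \<comment> \<open>\<open>sqrt \<kappa> / 2\<close> makes \<open>q 0 < \<kappa> / 4\<close>, while
    \<open>q\<close> exceeds \<open>\<kappa> / 2 - \<kappa> / 4\<close> on the sphere, so the
    minimum is interior. \<open>R / 2\<close> is the share of \<open>v\<close> in the final norm
    bound.\<close>
  define r where "r = min (R / 2) (sqrt \<kappa> / 2)"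
  have "\<exists>g\<in>K. norm (\<Phi> g v - u) \<le> R \<and> \<Phi> g v - u \<in> normal_space" if v: "dist v u < r" for v
  proof -
    define q where "q \<eta> = ip (curve \<eta> - v) (curve \<eta> - v)" for \<eta>
    have "ip (v - u) (v - u) \<le> (norm (v - u))\<^sup>2" using ip_le by (simp add: power2_eq_square)
    also have "\<dots> < (sqrt \<kappa> / 2)\<^sup>2"
      using v by (intro power_strict_mono) (auto simp: r_def dist_norm)
    also have "\<dots> = \<kappa> / 4" using \<kappa> by (simp add: power_divide)
    finally have near: "ip (v - u) (v - u) < \<kappa> / 4" .
    have q0: "q 0 = ip (v - u) (v - u)"
      unfolding q_def by (simp add: ip.diff_left ip.diff_right)
    have "0 \<in> ?B" using subspace_0[OF subspace_k] \<rho> by simp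
    then obtain \<eta> where \<eta>: "\<eta> \<in> ?B" and min: "\<And>\<zeta>. \<zeta> \<in> ?B \<Longrightarrow> q \<eta> \<le> q \<zeta>"
      using continuous_attains_inf[OF \<open>compact ?B\<close> _ cont, of v] unfolding q_def by blast
    have "\<eta> \<notin> ?S"
    proof
      assume "\<eta> \<in> ?S"
      have "q \<eta> = ip ((curve \<eta> - u) - (v - u)) ((curve \<eta> - u) - (v - u))" by (simp add: q_def)
      then have "q \<eta> \<ge> ip (curve \<eta> - u) (curve \<eta> - u) / 2 - ip (v - u) (v - u)"
        using ip_diff_lower[of "curve \<eta> - u" "v - u"] by simp
      then show False using \<kappa>(2)[OF \<open>\<eta> \<in> ?S\<close>] near min[OF \<open>0 \<in> ?B\<close>] q0 by simp
    qed
    with \<eta> have \<eta>k: "\<eta> \<in> lie_algebra K" and interior: "norm \<eta> < \<rho>" by auto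
    let ?g = "mexp \<eta>"
    have g: "?g \<in> K" by (rule k_mexp1[OF \<eta>k])
    have orth: "ip (curve \<eta> - v) (\<Phi> ?g (generator \<zeta> u)) = 0" if \<zeta>: "\<zeta> \<in> lie_algebra K" for \<zeta>
    proof -
      have "((\<lambda>t. \<Phi> ?g (\<Phi> (mexp (t *\<^sub>R \<zeta>)) u)) has_vector_derivative \<Phi> ?g (generator \<zeta> u)) (at 0)"
        by (rule bounded_linear.has_vector_derivative[OF act_bounded_linear[OF K_G[OF g]]
              generator_has_derivative(1)[OF k_g[OF \<zeta>] u_D]])
      moreover have "\<Phi> ?g (\<Phi> (mexp (t *\<^sub>R \<zeta>)) u) = curve (\<eta> + t *\<^sub>R \<zeta>)" for t
        using curve_add[OF \<eta>k k_scale[OF \<zeta>]] by (simp add: curve_def)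
      ultimately have "((\<lambda>t. curve (\<eta> + t *\<^sub>R \<zeta>) - v) has_derivative
          (\<lambda>h. h *\<^sub>R \<Phi> ?g (generator \<zeta> u))) (at 0)"
        by (auto simp: has_vector_derivative_def intro!: derivative_eq_intros)
      from ip.FDERIV[OF this this]
      have "((\<lambda>t. q (\<eta> + t *\<^sub>R \<zeta>)) has_real_derivative
          2 * ip (curve \<eta> - v) (\<Phi> ?g (generator \<zeta> u))) (at 0)"
        unfolding q_def
        by (rule has_derivative_imp_has_field_derivative)
          (simp add: ip.scaleR_left ip.scaleR_right ip_commute)
      \<comment> \<open>The time span for which \<open>\<eta> + t *\<^sub>R \<zeta>\<close> stays in
        the ball; the \<open>+ 1\<close> covers \<open>\<zeta> = 0\<close>.\<close>
      moreover define \<tau> where "\<tau> = (\<rho> - norm \<eta>) / (norm \<zeta> + 1)"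
      moreover have "\<tau> > 0" using interior by (simp add: \<tau>_def add_nonneg_pos)
      moreover have "q (\<eta> + 0 *\<^sub>R \<zeta>) \<le> q (\<eta> + t *\<^sub>R \<zeta>)" if "\<bar>0 - t\<bar> < \<tau>" for t
      proof -
        have "norm (t *\<^sub>R \<zeta>) \<le> \<tau> * (norm \<zeta> + 1)" using that by (auto intro!: mult_mono)
        also have "\<dots> = \<rho> - norm \<eta>" by (simp add: \<tau>_def add_nonneg_pos less_imp_neq[symmetric])
        finally have "norm (\<eta> + t *\<^sub>R \<zeta>) \<le> \<rho>" using norm_triangle_ineq[of \<eta> "t *\<^sub>R \<zeta>"] by simp
        then show ?thesis
          using subspace_add[OF subspace_k \<eta>k k_scale[OF \<zeta>]] by (simp add: min)
      qed
      ultimately have "2 * ip (curve \<eta> - v) (\<Phi> ?g (generator \<zeta> u)) = 0"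
        using DERIV_local_min by blast
      then show ?thesis by simp
    qed
    \<comment> \<open>The inverse takes \<open>curve \<eta>\<close> back to \<open>u\<close>, and as
      a linear isometry of \<open>ip\<close> it carries the orthogonality found at
      \<open>curve \<eta>\<close> to \<open>u\<close>.\<close>
    let ?h = "matrix_inv ?g"
    have h: "?h \<in> K" by (rule K_inv[OF g])
    interpret h: bounded_linear "\<Phi> ?h" by (rule act_bounded_linear[OF K_G[OF h]])
    have hv: "\<Phi> ?h (curve \<eta> - v) = u - \<Phi> ?h v"
      by (simp add: h.diff curve_def act_inv K_G[OF g])
    have "\<Phi> ?h v - u \<in> normal_space"
    proof (rule normal_spaceI)
      fix \<zeta> assume "\<zeta> \<in> lie_algebra K"
      from orth[OF this] have "ip (\<Phi> ?h (curve \<eta> - v)) (\<Phi> ?h (\<Phi> ?g (generator \<zeta> u))) = 0"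
        by (simp add: act_ip K_G[OF h])
      then show "ip (\<Phi> ?h v - u) (generator \<zeta> u) = 0"
        by (simp add: hv act_inv K_G[OF g] ip.diff_left)
    qed
    moreover have "norm (\<Phi> ?h v - u) \<le> R"
    proof -
      have "norm (\<Phi> ?h v - u) = dist (curve \<eta>) v"
        using hv act_norm[OF K_G[OF h], of "curve \<eta> - v"] by (simp add: dist_norm norm_minus_commute)
      also have "\<dots> \<le> dist (curve \<eta>) u + dist v u" by (rule dist_triangle2)
      finally show ?thesis using d(2)[OF \<eta>k] interior \<rho> v by (simp add: r_def)
    qed
    ultimately show ?thesis using h by blast
  qed
  moreover have "r > 0" using \<open>R > 0\<close> \<kappa> by (simp add: r_def)
  ultimately show ?thesis by blast
qed


section \<open>The Lyapunov function near the orbit\<close>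

definition lyapunov :: "real \<Rightarrow> 'a \<Rightarrow> real" where
  "lyapunov \<kappa> v = L v + \<kappa> * (\<Sum>j<m. (Fam (e j) v - \<mu> j)\<^sup>2)"

lemma lyapunov_act: "g \<in> K \<Longrightarrow> lyapunov \<kappa> (\<Phi> g v) = lyapunov \<kappa> v"
  by (simp add: lyapunov_def L_act penalty_act)

lemma lyapunov_conserved: "lyapunov \<kappa> (\<Phi>H t v) = lyapunov \<kappa> v"
  by (simp add: lyapunov_def L_eq H_conserved Fam_conserved k_g[OF \<xi>] basis_in)

lemma lyapunov_has_derivative:
  "(lyapunov \<kappa> has_derivative
    (Dblin L v + (2 * \<kappa>) *\<^sub>R (\<Sum>j<m. (Fam (e j) v - \<mu> j) *\<^sub>R Dblin (Fam (e j)) v))) (at v)"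
proof -
  have "((\<lambda>v. \<Sum>j<m. (Fam (e j) v - \<mu> j)\<^sup>2) has_derivative
      (\<lambda>w. \<Sum>j<m. 2 * ((Fam (e j) v - \<mu> j) * Dblin (Fam (e j)) v w))) (at v)"
    by (intro has_derivative_sum)
      (auto intro!: derivative_eq_intros Fam_has_derivative basis_in simp: fun_eq_iff)
  from has_derivative_add[OF L_has_derivative has_derivative_mult_right[OF this, of \<kappa>]]
  show ?thesis
    unfolding lyapunov_def[abs_def]
    by (rule has_derivative_eq_rhs)
      (simp add: fun_eq_iff blinfun.bilinear_simps sum_distrib_left mult_ac)
qed

text \<open>At \<open>u\<close> the factors \<open>Fam (e j) u - \<mu> j\<close> vanish, so second
  derivatives of the momentum drop out of the penalty part.\<close>

lemma lyapunov_derivative_has_derivative: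
  "((\<lambda>v. Dblin L v + (2 * \<kappa>) *\<^sub>R (\<Sum>j<m. (Fam (e j) v - \<mu> j) *\<^sub>R Dblin (Fam (e j)) v)) has_derivative
    (\<lambda>w. Dblin (Dblin L) u w + (2 * \<kappa>) *\<^sub>R (\<Sum>j<m. Dblin (Fam (e j)) u w *\<^sub>R Dblin (Fam (e j)) u))) (at u)"
proof -
  have "((\<lambda>v. (Fam (e j) v - \<mu> j) *\<^sub>R Dblin (Fam (e j)) v) has_derivative
      (\<lambda>w. Dblin (Fam (e j)) u w *\<^sub>R Dblin (Fam (e j)) u)) (at u)" if "j < m" for j
    using that by (auto intro!: derivative_eq_intros Fam_has_derivative basis_in C2D(2) C2_Fam simp: Fam_u)
  then show ?thesis
    by (intro has_derivative_add Dblin_L_has_derivative has_derivative_scaleR_right has_derivative_sum) auto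
qed

lemma lyapunov_coercive:
  assumes z: "\<And>j w. j < m \<Longrightarrow> Dblin (Fam (e j)) u w = ip (z j) w" and "c > 0"
    and coercive: "\<And>w. w \<in> tangent_level m e Fam u \<inter> normal_space \<Longrightarrow> D2 L u w w \<ge> c * (norm w)\<^sup>2"
  shows "\<exists>\<kappa>. \<exists>c'>0. \<exists>R>0. \<forall>w\<in>normal_space. norm w \<le> R \<longrightarrow>
    lyapunov \<kappa> (u + w) - lyapunov \<kappa> u \<ge> c' * (norm w)\<^sup>2"
proof -
  have "bounded_bilinear (D2 L u)"
    unfolding D2_def[abs_def]
    by (rule bounded_bilinear.comp1[OF bounded_bilinear_blinfun_apply blinfun.bounded_linear_right])
  \<comment> \<open>\<open>Fam (e j)\<close> equals \<open>\<mu> j\<close> along the orbit of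
    \<open>K\<close> through \<open>u\<close>, so its derivative at \<open>u\<close> kills the
    generators.\<close>
  moreover have "z j \<in> normal_space" if j: "j < m" for j
  proof (rule normal_spaceI)
    fix \<eta> assume \<eta>: "\<eta> \<in> lie_algebra K"
    have "((\<lambda>t. Fam (e j) (\<Phi> (mexp (t *\<^sub>R \<eta>)) u)) has_derivative
        (\<lambda>h. Dblin (Fam (e j)) (\<Phi> (mexp (0 *\<^sub>R \<eta>)) u) (h *\<^sub>R generator \<eta> u))) (at 0)"
      using generator_has_derivative(1)[OF k_g[OF \<eta>] u_D] Fam_has_derivative[OF basis_in[OF j]]
      unfolding has_vector_derivative_def by (rule has_derivative_compose)
    moreover have "Fam (e j) (\<Phi> (mexp (t *\<^sub>R \<eta>)) u) = \<mu> j" for t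
      using k_mexp[OF \<eta>, of t] j by (auto simp: mem_K momentum_def)
    ultimately have "((\<lambda>t. \<mu> j) has_derivative (\<lambda>h. Dblin (Fam (e j)) u (h *\<^sub>R generator \<eta> u))) (at (0 :: real))"
      by (simp add: act_one)
    then have "(\<lambda>h. Dblin (Fam (e j)) u (h *\<^sub>R generator \<eta> u)) = (\<lambda>h. 0)"
      by (rule has_derivative_unique) simp
    from fun_cong[OF this, of 1] show "ip (z j) (generator \<eta> u) = 0" by (simp add: z j)
  qed
  moreover have "D2 L u w w \<ge> c * (norm w)\<^sup>2"
    if "w \<in> normal_space" "\<And>j. j \<in> {..<m} \<Longrightarrow> ip (z j) w = 0" for w
    using that by (intro coercive) (auto simp: tangent_level_def D_momentum_def z fun_eq_iff restrict_def)
  ultimately obtain \<kappa> c' where \<kappa>: "\<kappa> \<ge> 0" and c': "c' > 0"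
    and lower: "\<And>w. w \<in> normal_space \<Longrightarrow> D2 L u w w + \<kappa> * (\<Sum>j<m. (ip (z j) w)\<^sup>2) \<ge> c' * (norm w)\<^sup>2"
    using coercive_penalised[OF ip finite_lessThan _ subspace_normal_space _ \<open>c > 0\<close>, of "D2 L u" m z]
    by auto
  have crit: "Dblin L u + (2 * (\<kappa> / 2)) *\<^sub>R (\<Sum>j<m. (Fam (e j) u - \<mu> j) *\<^sub>R Dblin (Fam (e j)) u) = 0"
    by (simp add: critical Fam_u)
  \<comment> \<open>The weight is \<open>\<kappa> / 2\<close> because differentiating a square twice
    contributes a factor 2. The error \<open>c' / 2\<close> leaves half of \<open>c'\<close>, and
    the Taylor factor 1/2 then gives \<open>c' / 4\<close>.\<close>
  obtain R where R: "R > 0" and taylor: "\<And>w. norm w \<le> R \<Longrightarrow>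
      lyapunov (\<kappa> / 2) (u + w) - lyapunov (\<kappa> / 2) u \<ge>
      ((Dblin (Dblin L) u w + (2 * (\<kappa> / 2)) *\<^sub>R (\<Sum>j<m. Dblin (Fam (e j)) u w *\<^sub>R Dblin (Fam (e j)) u)) w
        - c' / 2 * (norm w)\<^sup>2) / 2"
    using second_order_lower_bound[OF lyapunov_has_derivative lyapunov_derivative_has_derivative crit, of "c' / 2"]
      c' by auto
  have "lyapunov (\<kappa> / 2) (u + w) - lyapunov (\<kappa> / 2) u \<ge> c' / 4 * (norm w)\<^sup>2"
    if w: "w \<in> normal_space" "norm w \<le> R" for w
  proof -
    have "(Dblin (Dblin L) u w + (2 * (\<kappa> / 2)) *\<^sub>R (\<Sum>j<m. Dblin (Fam (e j)) u w *\<^sub>R Dblin (Fam (e j)) u)) w =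
        D2 L u w w + \<kappa> * (\<Sum>j<m. (ip (z j) w)\<^sup>2)"
      by (simp add: blinfun.bilinear_simps D2_def z power2_eq_square)
    then show ?thesis using taylor[OF w(2)] lower[OF w(1)] by simp
  qed
  then show ?thesis using c' R by (intro exI[of _ "\<kappa> / 2"] exI[of _ "c' / 4"] conjI exI[of _ R]) auto
qed

text \<open>The slice exists only around \<open>u\<close>, so \<open>v\<close> is first carried near
  \<open>u\<close> by a group element and then into the slice by another; both preserve the Lyapunov
  function and distances to the orbit.\<close>

lemma lyapunov_controls_distance:
  assumes z: "\<And>j w. j < m \<Longrightarrow> Dblin (Fam (e j)) u w = ip (z j) w" and "c > 0"
    and coercive: "\<And>w. w \<in> tangent_level m e Fam u \<inter> normal_space \<Longrightarrow> D2 L u w w \<ge> c * (norm w)\<^sup>2"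
  shows "\<exists>\<kappa>. \<exists>c'>0. \<exists>r>0. \<forall>v. infdist v (orbit \<Phi> K u) < r \<longrightarrow>
    lyapunov \<kappa> v - lyapunov \<kappa> u \<ge> c' * (infdist v (orbit \<Phi> K u))\<^sup>2"
proof -
  obtain \<kappa> c' R where c': "c' > 0" and R: "R > 0" and lower: "\<And>w. w \<in> normal_space \<Longrightarrow> norm w \<le> R \<Longrightarrow>
      lyapunov \<kappa> (u + w) - lyapunov \<kappa> u \<ge> c' * (norm w)\<^sup>2"
    using lyapunov_coercive[OF z \<open>c > 0\<close> coercive] by blast
  obtain r where r: "r > 0" and slice: "\<And>v. dist v u < r \<Longrightarrow>
      \<exists>g\<in>K. norm (\<Phi> g v - u) \<le> R \<and> \<Phi> g v - u \<in> normal_space"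
    using slice[OF R] by blast
  have "lyapunov \<kappa> v - lyapunov \<kappa> u \<ge> c' * (infdist v (orbit \<Phi> K u))\<^sup>2"
    if v: "infdist v (orbit \<Phi> K u) < r" for v
  proof -
    have "orbit \<Phi> K u \<noteq> {}" using K_one by (auto simp: orbit_def)
    with v obtain g where g: "g \<in> K" and near: "dist v (\<Phi> g u) < r"
      by (elim infdist_lessE) (auto simp: orbit_def)
    let ?h = "matrix_inv g"
    have h: "?h \<in> K" by (rule K_inv[OF g])
    have "dist (\<Phi> ?h v) u = dist v (\<Phi> g u)"
      using act_dist[OF K_G[OF h], of v "\<Phi> g u"] by (simp add: act_inv K_G[OF g])
    then obtain k where k: "k \<in> K" "norm (\<Phi> k (\<Phi> ?h v) - u) \<le> R" "\<Phi> k (\<Phi> ?h v) - u \<in> normal_space"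
      using slice near by metis
    \<comment> \<open>\<open>?a\<close> is the orbit point that the two moves take to
      \<open>u\<close>, so \<open>norm ?w\<close> is the distance from \<open>v\<close> to
      \<open>?a\<close>.\<close>
    let ?w = "\<Phi> k (\<Phi> ?h v) - u" and ?a = "\<Phi> g (\<Phi> (matrix_inv k) u)"
    have "?a = \<Phi> (g ** matrix_inv k) u" by (simp add: act_mult K_G K_inv g k)
    then have a: "?a \<in> orbit \<Phi> K u" using K_mult[OF g K_inv[OF k(1)]] by (auto simp: orbit_def)
    have "dist v ?a = dist (\<Phi> ?h v) (\<Phi> ?h ?a)" by (simp add: act_dist K_G[OF h])
    also have "\<dots> = dist (\<Phi> k (\<Phi> ?h v)) (\<Phi> k (\<Phi> ?h ?a))" by (simp add: act_dist K_G[OF k(1)])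
    also have "\<Phi> k (\<Phi> ?h ?a) = u" by (simp add: act_inv K_G g k)
    finally have "infdist v (orbit \<Phi> K u) \<le> norm ?w"
      using infdist_le[OF a, of v] by (simp add: dist_norm)
    then have "c' * (infdist v (orbit \<Phi> K u))\<^sup>2 \<le> c' * (norm ?w)\<^sup>2"
      using c' by (intro mult_left_mono power_mono infdist_nonneg) auto
    also have "\<dots> \<le> lyapunov \<kappa> v - lyapunov \<kappa> u"
      using lower[OF k(3,2)] by (simp add: lyapunov_act k h)
    finally show ?thesis .
  qed
  then show ?thesis using c' r by blast
qed

lemma orbit_stable:
  assumes z: "\<And>j w. j < m \<Longrightarrow> Dblin (Fam (e j)) u w = ip (z j) w" and "c > 0"
    and coercive: "\<And>w. w \<in> tangent_level m e Fam u \<inter> normal_space \<Longrightarrow> D2 L u w w \<ge> c * (norm w)\<^sup>2"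
    and v: "v \<in> orbit \<Phi> K u" and "\<epsilon> > 0"
  shows "\<exists>\<delta>>0. \<forall>w. dist w v \<le> \<delta> \<longrightarrow> (\<forall>t. infdist (\<Phi>H t w) (orbit \<Phi> K u) \<le> \<epsilon>)"
proof -
  let ?O = "orbit \<Phi> K u"
  obtain \<kappa> c' r where c': "c' > 0" and r: "r > 0"
    and lower: "\<And>v. infdist v ?O < r \<Longrightarrow> lyapunov \<kappa> v - lyapunov \<kappa> u \<ge> c' * (infdist v ?O)\<^sup>2"
    using lyapunov_controls_distance[OF z \<open>c > 0\<close> coercive] by blast
  \<comment> \<open>Strictly below \<open>r\<close>, so that the lower bound still holds at distance
    exactly \<open>\<epsilon>'\<close>.\<close>
  define \<epsilon>' where "\<epsilon>' = min \<epsilon> (r / 2)"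
  have \<epsilon>': "\<epsilon>' > 0" "\<epsilon>' \<le> \<epsilon>" "\<epsilon>' < r" using r \<open>\<epsilon> > 0\<close> by (auto simp: \<epsilon>'_def)
  have at_v: "lyapunov \<kappa> v = lyapunov \<kappa> u" using v by (auto simp: orbit_def lyapunov_act)
  have "isCont (lyapunov \<kappa>) v" by (rule has_derivative_continuous[OF lyapunov_has_derivative])
  then obtain d where d: "d > 0" "\<And>w. dist w v < d \<Longrightarrow> dist (lyapunov \<kappa> w) (lyapunov \<kappa> v) < c' * \<epsilon>'\<^sup>2"
    using c' \<epsilon>'(1) unfolding continuous_at_eps_delta by (metis mult_pos_pos zero_less_power)
  define \<delta> where "\<delta> = min (d / 2) \<epsilon>'"
  have "infdist (\<Phi>H t w) ?O \<le> \<epsilon>'" if w: "dist w v \<le> \<delta>" for w t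
  proof (rule ccontr)
    assume far: "\<not> infdist (\<Phi>H t w) ?O \<le> \<epsilon>'"
    have cont: "continuous_on UNIV (\<lambda>t. infdist (\<Phi>H t w) ?O)"
      by (intro continuous_on_infdist flow_H_continuous)
    have "infdist (\<Phi>H 0 w) ?O \<le> \<epsilon>'"
      using infdist_le[OF v, of w] w by (simp add: flow_H_zero \<delta>_def)
    then have "\<epsilon>' \<in> closed_segment (infdist (\<Phi>H 0 w) ?O) (infdist (\<Phi>H t w) ?O)"
      using far by (simp add: closed_segment_eq_real_ivl)
    \<comment> \<open>A trajectory that escapes crosses distance \<open>\<epsilon>'\<close> at some
      time \<open>s\<close>; there the conserved value would exceed the one at \<open>v\<close> by
      at least \<open>c' * \<epsilon>'\<^sup>2\<close>.\<close>
    then obtain s where s: "infdist (\<Phi>H s w) ?O = \<epsilon>'"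
      using IVT'_closed_segment_real[of \<epsilon>' "\<lambda>t. infdist (\<Phi>H t w) ?O" 0 t]
        continuous_on_subset[OF cont] by blast
    have "c' * \<epsilon>'\<^sup>2 \<le> lyapunov \<kappa> w - lyapunov \<kappa> v"
      using lower[of "\<Phi>H s w"] s \<epsilon>' by (simp add: lyapunov_conserved at_v)
    moreover have "dist w v < d" using w d(1) by (simp add: \<delta>_def)
    ultimately show False using d(2) by (fastforce simp: dist_real_def)
  qed
  moreover have "\<delta> > 0" using d \<epsilon>' by (simp add: \<delta>_def)
  ultimately show ?thesis using \<epsilon>'(2) by (meson order_trans)
qed

end

theorem theorem8p11:
  fixes ip :: "'a::banach \<Rightarrow> 'a \<Rightarrow> real"
    and D :: "'a set"
    and J :: "'a \<Rightarrow> 'a \<Rightarrow>\<^sub>L real"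
    and H :: "'a \<Rightarrow> real"
    and \<Phi>H :: "real \<Rightarrow> 'a \<Rightarrow> 'a"
    and G :: "(real^'n^'n) set"
    and m :: nat
    and e :: "nat \<Rightarrow> real^'n^'n"
    and \<Phi> :: "real^'n^'n \<Rightarrow> 'a \<Rightarrow> 'a"
    and Fam :: "real^'n^'n \<Rightarrow> 'a \<Rightarrow> real"
    and \<mu> :: "nat \<Rightarrow> real"
    and u\<mu> :: 'a
    and \<xi>\<mu> :: "real^'n^'n"
  defines "G\<mu> \<equiv> stabilizer G m e \<mu>"
    and "L \<equiv> lagrangian m e Fam H \<xi>\<mu>"
  assumes "continuous_scalar_product ip"
    and "is_domain D"
    and "symplector J"
    and "C2 H" and "H \<in> Dif D J"
    and "hamiltonian_flow D J H \<Phi>H"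
    and "matrix_lie_group G"
    and "lie_basis G m e"
    and "globally_hamiltonian D J G \<Phi> Fam"
    and "Ad_star_equivariant G m e \<Phi> Fam"
    and "\<forall>j<m. C2 (Fam (e j))"
    and "\<mu> \<in> {..<m} \<rightarrow>\<^sub>E UNIV"
    and "u\<mu> \<in> D \<inter> level_set m e Fam \<mu>"
    and "\<forall>g\<in>G. linear (\<Phi> g) \<and> (\<forall>v w. ip (\<Phi> g v) (\<Phi> g w) = ip v w) \<and>
           (\<forall>v. norm (\<Phi> g v) = norm v)"
    and "\<forall>g\<in>G\<mu>. Ad_star_orthogonal m e g"
    and "regular_value m e Fam \<mu>"
    and "\<forall>g\<in>G. H \<circ> \<Phi> g = H"
    and "\<xi>\<mu> \<in> lie_algebra G\<mu>"
    and "Dblin L u\<mu> = 0"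
    and "\<forall>j<m. \<exists>z. \<forall>w. blinfun_apply (Dblin (Fam (e j)) u\<mu>) w = ip z w"
    and "\<forall>g\<in>G\<mu>. \<forall>h\<in>G\<mu>. g ** h = h ** g"
    and "\<exists>C>0. \<forall>w. D2 L u\<mu> w w \<le> C * (norm w)\<^sup>2"
    and "\<exists>c>0. \<forall>w \<in> tangent_level m e Fam u\<mu> \<inter> ip_orth ip (tangent_orbit \<Phi> G\<mu> u\<mu>).
           D2 L u\<mu> w w \<ge> c * (norm w)\<^sup>2"
  shows "\<forall>u \<in> orbit \<Phi> G\<mu> u\<mu>.
           relative_equilibrium G\<mu> \<Phi> \<Phi>H u \<and> orbitally_stable G\<mu> \<Phi> \<Phi>H u"
proof -
  have level: "u\<mu> \<in> level_set m e Fam \<mu>" and u\<mu>: "u\<mu> \<in> D" "momentum m e Fam u\<mu> = \<mu>"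
    using \<open>u\<mu> \<in> D \<inter> level_set m e Fam \<mu>\<close> by (auto simp: level_set_def)
  interpret constrained_critical_point ip D J H \<Phi>H G m e \<Phi> Fam \<mu> u\<mu> \<xi>\<mu>
    by unfold_locales (use assms level u\<mu> in \<open>auto simp: G\<mu>_def L_def regular_value_def\<close>)
  obtain z where z: "\<And>j w. j < m \<Longrightarrow> Dblin (Fam (e j)) u\<mu> w = ip (z j) w"
    using \<open>\<forall>j<m. \<exists>z. \<forall>w. blinfun_apply (Dblin (Fam (e j)) u\<mu>) w = ip z w\<close> by metis
  obtain c where c: "c > 0" "\<And>w. w \<in> tangent_level m e Fam u\<mu> \<inter> normal_space \<Longrightarrow>
      D2 L u\<mu> w w \<ge> c * (norm w)\<^sup>2"
    using \<open>\<exists>c>0. \<forall>w \<in> tangent_level m e Fam u\<mu> \<inter> ip_orth ip (tangent_orbit \<Phi> G\<mu> u\<mu>).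
           D2 L u\<mu> w w \<ge> c * (norm w)\<^sup>2\<close> unfolding G\<mu>_def by blast
  show ?thesis
  proof
    fix u assume u: "u \<in> orbit \<Phi> G\<mu> u\<mu>"
    then have u': "u \<in> orbit \<Phi> K u\<mu>" by (simp add: G\<mu>_def)
    have flow: "\<Phi>H t u \<in> orbit \<Phi> K u" for t by (rule flow_H_orbit_mem[OF u'])
    \<comment> \<open>The trajectory of \<open>u\<close> stays in one orbit, so the infimum over
      \<open>t'\<close> in the definition of stability is that of a constant.\<close>
    have "orbit \<Phi> G\<mu> (\<Phi>H t u) = orbit \<Phi> K u\<mu>" for t
      using orbit_eq[of "\<Phi>H t u"] flow[of t] orbit_eq[OF u'] by (simp add: G\<mu>_def)
    then have "orbitally_stable G\<mu> \<Phi> \<Phi>H u"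
      using orbit_stable[OF z c(1) c(2)[unfolded L_def] u'] by (simp add: orbitally_stable_def)
    then show "relative_equilibrium G\<mu> \<Phi> \<Phi>H u \<and> orbitally_stable G\<mu> \<Phi> \<Phi>H u"
      using flow by (simp add: relative_equilibrium_def G\<mu>_def)
  qed
qed

end
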